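(* Let $X$ be a densely repetitive Delone set in $\mathbb{R}^n$ and let $\mathbf{w}$ be a local weight distribution on $X$ with values in $\mathbb{R}^s$. Then there is an $\mathbf{f}\in\mathbb{R}^s$ with $$\frac{\mathbf{w}(B)}{\operatorname{vol}_n(B)}=\mathbf{f}+o(1)$$ as $\omega(B)$ tends to infinity, where $B$ ranges over boxes in $\mathbb{R}^n$.
   Context: A Delone set in $\mathbb{R}^n$ is a set $X\subset\mathbb{R}^n$ for which there are $r,R>0$ such that each open ball of radius $r$ contains at most one point of $X$ and each closed ball of radius $R$ contains at least one point of $X$. $B(\mathbf{x};T)$ is the closed ball of radius $T$ centered at $\mathbf{x}$. $N_X(T)$ is the number of distinct sets $(X\cap B(\mathbf{x};T))-\mathbf{x}$, $\mathbf{x}\in X$. $X$ is repetitive if for each $T>0$ there is a finite $M>0$ such that every closed ball of radius $M$ in $\mathbb{R}^n$ contains, for every $\mathbf{y}\in X$, some $\mathbf{x}\in X$ with $(X\cap B(\mathbf{x};T))-\mathbf{x}=(X\cap B(\mathbf{y};T))-\mathbf{y}$; $M_X(T)$ denotes the least such $M$. $X$ is densely repetitive if it is repetitive and $M_X(T)=O(N_X(T)^{1/n})$ as $T\to\infty$. A box is a set $B=\prod_{i=1}^n[a_i,b_i]$ with $a_i<b_i$; with $l_i=b_i-a_i$, its volume is $\operatorname{vol}_n(B)=\prod l_i$, its surface area is $\sigma(B)=2\operatorname{vol}_n(B)\sum_{i=1}^n 1/l_i$ and its width is $\omega(B)=\min_i l_i$. A local weight distribution on $X$ is a function $\mathbf{w}$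 with values in $\mathbb{R}^s$ whose domain is the set of all boxes $B$ in $\mathbb{R}^n$ with $\omega(B)>U_0$ (for some $U_0\ge0$) such that, with $O$-constants depending only on $\mathbf{w}$ and for boxes in the domain: (a) $\mathbf{w}(B)=O(\operatorname{vol}_n(B))$; (b) if $(B+\mathbf{t})\cap X=(B\cap X)+\mathbf{t}$ for some $\mathbf{t}\in\mathbb{R}^n$, then $\mathbf{w}(B+\mathbf{t})=\mathbf{w}(B)+O(\sigma(B))$; (c) if $B=B_1\cup\cdots\cup B_k$ is a partition of $B$ into non-overlapping smaller boxes, then $\mathbf{w}(B)=\sum_{i=1}^k\mathbf{w}(B_i)+O\left(\sum_{i=1}^k\sigma(B_i)\right)$. *)

theory Defs
  imports "HOL-Analysis.Analysis" "HOL-Library.Landau_Symbols" "HOL-Library.Going_To_Filter"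
begin

definition delone :: "(real ^ 'n) set \<Rightarrow> bool" where
  "delone X \<longleftrightarrow> (\<exists>r>0. \<exists>R>0.
     (\<forall>c. \<forall>x \<in> X \<inter> ball c r. \<forall>y \<in> X \<inter> ball c r. x = y) \<and>
     (\<forall>c. X \<inter> cball c R \<noteq> {}))"

definition patch :: "(real ^ 'n) set \<Rightarrow> real \<Rightarrow> real ^ 'n \<Rightarrow> (real ^ 'n) set" where
  "patch X T x = (\<lambda>z. z - x) ` (X \<inter> cball x T)"

text \<open>For a repetitive Delone set the set of patches is finite for every \<open>T > 0\<close>
  (\<open>finite_patches\<close> below), so \<^const>\<open>card\<close> does not default to 0 there.\<close>

definition patch_count :: "(real ^ 'n) set \<Rightarrow> real \<Rightarrow> nat" where
  "patch_count X T = card (patch X T ` X)"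

definition repetitivity_radius :: "(real ^ 'n) set \<Rightarrow> real \<Rightarrow> real \<Rightarrow> bool" where
  "repetitivity_radius X T M \<longleftrightarrow> M > 0 \<and>
     (\<forall>c. \<forall>y\<in>X. \<exists>x \<in> X \<inter> cball c M. patch X T x = patch X T y)"

definition repetitive :: "(real ^ 'n) set \<Rightarrow> bool" where
  "repetitive X \<longleftrightarrow> (\<forall>T>0. \<exists>M. repetitivity_radius X T M)"

text \<open>The least radius exists for a repetitive Delone set
  (\<open>repetitivity_function\<close> below).\<close>

definition repetitivity_function :: "(real ^ 'n) set \<Rightarrow> real \<Rightarrow> real" where
  "repetitivity_function X T = (LEAST M. repetitivity_radius X T M)"

definition densely_repetitive :: "(real ^ 'n) set \<Rightarrow> bool" where
  "densely_repetitive X \<longleftrightarrow> repetitive X \<and>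
     repetitivity_function X \<in> O[at_top](\<lambda>T. real (patch_count X T) powr (1 / real CARD('n)))"

definition is_box :: "(real ^ 'n) set \<Rightarrow> bool" where
  "is_box B \<longleftrightarrow> (\<exists>a b. (\<forall>i. a $ i < b $ i) \<and> B = cbox a b)"

definition side :: "(real ^ 'n) set \<Rightarrow> 'n \<Rightarrow> real" where
  "side B i = interval_upperbound B $ i - interval_lowerbound B $ i"

definition vol :: "(real ^ 'n) set \<Rightarrow> real" where
  "vol B = (\<Prod>i\<in>UNIV. side B i)"

definition surface_area :: "(real ^ 'n) set \<Rightarrow> real" where
  "surface_area B = 2 * vol B * (\<Sum>i\<in>UNIV. 1 / side B i)"

definition width :: "(real ^ 'n) set \<Rightarrow> real" where
  "width B = Min (range (side B))"

definition boxes_wider_than :: "real \<Rightarrow> (real ^ 'n) set set" where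
  "boxes_wider_than U = {B. is_box B \<and> width B > U}"

text \<open>The weight is a total function on sets, of which only the values on
  \<^term>\<open>boxes_wider_than U0\<close> are constrained. The constants \<open>Ca\<close>, \<open>Cb\<close>, \<open>Cc\<close> are uniform
  in the boxes, the translation and the partition, including its number of parts. In
  \<^term>\<open>D division_of B\<close> the members of \<^term>\<open>D\<close> have pairwise disjoint interiors.\<close>

definition local_weight_distribution ::
    "(real ^ 'n) set \<Rightarrow> ((real ^ 'n) set \<Rightarrow> real ^ 's) \<Rightarrow> bool" where
  "local_weight_distribution X w \<longleftrightarrow> (\<exists>U0\<ge>0.
     (\<exists>Ca. \<forall>B \<in> boxes_wider_than U0. norm (w B) \<le> Ca * vol B) \<and>
     (\<exists>Cb. \<forall>B \<in> boxes_wider_than U0. \<forall>t.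
        (+) t ` B \<inter> X = (+) t ` (B \<inter> X) \<longrightarrow>
        norm (w ((+) t ` B) - w B) \<le> Cb * surface_area B) \<and>
     (\<exists>Cc. \<forall>B \<in> boxes_wider_than U0. \<forall>D \<subseteq> boxes_wider_than U0.
        D division_of B \<longrightarrow>
        norm (w B - (\<Sum>K\<in>D. w K)) \<le> Cc * (\<Sum>K\<in>D. surface_area K)))"

lemma
  fixes a b :: "real ^ 'n"
  assumes "\<And>i. a $ i < b $ i"
  shows side_cbox: "side (cbox a b) i = b $ i - a $ i"
    and vol_cbox: "vol (cbox a b) = measure lborel (cbox a b)"
proof -
  have ne: "cbox a b \<noteq> {}"
    using assms by (auto simp: interval_ne_empty_cart intro: less_imp_le)
  have le: "\<forall>i\<in>Basis. a \<bullet> i \<le> b \<bullet> i"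
    using ne by (simp add: box_ne_empty)
  show *: "side (cbox a b) i = b $ i - a $ i" for i
    using le by (simp add: side_def)
  show "vol (cbox a b) = measure lborel (cbox a b)"
    using ne by (simp add: vol_def * content_cbox_cart)
qed

lemma delone_closed_subset:
  assumes "delone X" and "A \<subseteq> X"
  shows "closed A"
proof -
  obtain r where r: "r > 0" "\<forall>c. \<forall>x \<in> X \<inter> ball c r. \<forall>y \<in> X \<inter> ball c r. x = y"
    using assms(1) by (auto simp: delone_def)
  have "\<forall>x\<in>A. \<forall>y\<in>A. dist y x < r \<longrightarrow> y = x"
  proof (intro ballI impI)
    fix x y assume "x \<in> A" "y \<in> A" "dist y x < r"
    then have "x \<in> X \<inter> ball x r" "y \<in> X \<inter> ball x r"
      using r(1) assms(2) by (auto simp: dist_commute)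
    then show "y = x" using r(2) by blast
  qed
  then show ?thesis
    using r(1) discrete_imp_closed by blast
qed

lemma delone_finite_cball:
  assumes "delone X"
  shows "finite (X \<inter> cball c M)"
proof (rule ccontr)
  assume inf: "infinite (X \<inter> cball c M)"
  obtain z where z: "z islimpt (X \<inter> cball c M)"
    using Heine_Borel_imp_Bolzano_Weierstrass[OF compact_cball inf inf_le2] by blast
  have "closed ((X \<inter> cball c M) - {z})"
    by (rule delone_closed_subset[OF assms]) auto
  moreover have "z islimpt ((X \<inter> cball c M) - {z})"
    using z unfolding islimpt_def by blast
  ultimately show False
    unfolding closed_limpt by blast
qed

lemma finite_patches:
  assumes "delone X" and "repetitive X" and "T > 0"
  shows "finite (patch X T ` X)"
proof -
  obtain M where "repetitivity_radius X T M"
    using assms(2,3) by (auto simp: repetitive_def)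
  then have M: "\<exists>x \<in> X \<inter> cball 0 M. patch X T x = patch X T y" if "y \<in> X" for y
    using that unfolding repetitivity_radius_def by blast
  have "patch X T ` X \<subseteq> patch X T ` (X \<inter> cball 0 M)"
  proof (rule image_subsetI)
    fix y assume "y \<in> X"
    then obtain x where "x \<in> X \<inter> cball 0 M" "patch X T x = patch X T y"
      using M by blast
    then show "patch X T y \<in> patch X T ` (X \<inter> cball 0 M)"
      by (simp add: rev_image_eqI)
  qed
  then show ?thesis
    using delone_finite_cball[OF assms(1)] finite_surj by blast
qed

lemma repetitivity_radius_Inf:
  fixes X :: "(real ^ 'n) set"
  assumes X: "delone X" and M: "repetitivity_radius X T M"
  defines "m \<equiv> Inf {M. repetitivity_radius X T M}"
  shows "repetitivity_radius X T m"
proof -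
  let ?S = "{M. repetitivity_radius X T M}"
  have ge: "m \<ge> 0"
    unfolding m_def using M by (intro cInf_greatest) (auto simp: repetitivity_radius_def)
  have main: "\<exists>x \<in> X \<inter> cball c m. patch X T x = patch X T y" if y: "y \<in> X" for c y
  proof -
    define A where "A = {x \<in> X. patch X T x = patch X T y}"
    have "closed A" "A \<noteq> {}"
      using y by (auto simp: A_def intro!: delone_closed_subset[OF X])
    then obtain x where x: "x \<in> A" "infdist c A = dist c x"
      using infdist_attains_inf by blast
    have "dist c x \<le> m"
      unfolding m_def
    proof (rule cInf_greatest)
      show "?S \<noteq> {}" using M by auto
    next
      fix M' assume "M' \<in> ?S"
      then have "\<exists>x' \<in> X \<inter> cball c M'. patch X T x' = patch X T y"
        using y unfolding repetitivity_radius_def mem_Collect_eq by blast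
      then obtain x' where "x' \<in> A" "dist c x' \<le> M'"
        unfolding A_def by auto
      then show "dist c x \<le> M'"
        using infdist_le[of x' A c] x(2) by linarith
    qed
    then show ?thesis using x(1) by (auto simp: A_def)
  qed
  have "m \<noteq> 0"
  proof
    assume "m = 0"
    obtain y where y: "y \<in> X" using X unfolding delone_def by blast
    have "X = UNIV" using main[OF y] \<open>m = 0\<close> by auto
    then have "finite (cball (0 :: real ^ 'n) 1)"
      using delone_finite_cball[OF X, of 0 1] by simp
    moreover have "infinite (cball (0 :: real ^ 'n) 1)"
      using uncountable_cball[of 1 "0 :: real ^ 'n"] countable_finite by auto
    ultimately show False by blast
  qed
  then show ?thesis
    using ge main by (simp add: repetitivity_radius_def)
qed

lemma repetitivity_function:
  fixes X :: "(real ^ 'n) set"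
  assumes "delone X" and "repetitive X" and "T > 0"
  shows "repetitivity_radius X T (repetitivity_function X T)"
    and "repetitivity_radius X T M \<Longrightarrow> repetitivity_function X T \<le> M"
proof -
  obtain M0 where M0: "repetitivity_radius X T M0"
    using assms(2,3) by (auto simp: repetitive_def)
  let ?m = "Inf {M. repetitivity_radius X T M}"
  have le: "?m \<le> M" if "repetitivity_radius X T M" for M
    using that by (intro cInf_lower bdd_belowI[of _ 0]) (auto simp: repetitivity_radius_def)
  note m = repetitivity_radius_Inf[OF assms(1) M0]
  have eq: "repetitivity_function X T = ?m"
    unfolding repetitivity_function_def by (rule Least_equality) (auto intro: m le)
  show "repetitivity_radius X T (repetitivity_function X T)"
    using m eq by simp
  show "repetitivity_radius X T M \<Longrightarrow> repetitivity_function X T \<le> M"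
    using le eq by simp
qed

end

theory Submission
  imports Defs
begin

text \<open>Let \<open>L\<close> and \<open>M\<close> be the lower and upper limits of \<open>v(B) / vol(B)\<close> for a scalar weight \<open>v\<close> and
  suppose \<open>L < M\<close>. Fix a large scale \<open>u\<close>. Up to \<open>O(1/u)\<close> the patch of radius \<open>n u\<close> at \<open>y \<in> X\<close>
  determines the density of \<open>v\<close> on the cube of side \<open>2 u\<close> about \<open>y\<close>, so, replacing \<open>v\<close> by \<open>- v\<close>
  if necessary, at least half of the patches have a cube of density at least \<open>(L + M) / 2\<close>.
  Dense repetitivity makes each of the \<open>N\<close> patches occur in every ball of radius \<open>O(N^(1/n))\<close>,
  hence together these rich patches occur with a frequency bounded below independently
  of \<open>u\<close>. Every large box is therefore filled by rich cubes to a fixed proportion, while the rest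
  of it has density at least \<open>L - \<epsilon>\<close>; this pushes its density above \<open>L\<close> by a fixed amount and
  contradicts the choice of \<open>L\<close>.\<close>

subsection \<open>Grid partitions of boxes\<close>

lemma vol_box:
  fixes a b :: "real ^ 'n"
  assumes "\<And>i. a $ i < b $ i"
  shows "vol (cbox a b) = (\<Prod>i\<in>UNIV. b $ i - a $ i)"
  unfolding vol_def by (simp add: side_cbox[OF assms])

lemma vol_pos: "is_box B \<Longrightarrow> vol B > 0"
  by (auto simp: is_box_def vol_box intro!: prod_pos)

lemma le_width_box:
  fixes a b :: "real ^ 'n"
  assumes "\<And>i. a $ i < b $ i"
  shows "u \<le> width (cbox a b) \<longleftrightarrow> (\<forall>i. u \<le> b $ i - a $ i)"
  unfolding width_def by (simp add: side_cbox[OF assms])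

lemma is_box_cbox: "(\<And>i. a $ i < b $ i) \<Longrightarrow> is_box (cbox a b)"
  by (auto simp: is_box_def)

text \<open>Each \<open>1 / side B i\<close> is at most \<open>1 / u\<close>. This turns every
  boundary error into an error of order \<open>1 / u\<close> in density.\<close>

lemma surface_area_le:
  fixes B :: "(real ^ 'n) set"
  assumes "is_box B" "u > 0" "u \<le> width B"
  shows "surface_area B \<le> 2 * real CARD('n) / u * vol B"
proof -
  have "side B i \<ge> u" for i
    using assms(3) by (auto simp: width_def)
  then have "(\<Sum>i\<in>UNIV. 1 / side B i) \<le> (\<Sum>i\<in>(UNIV::'n set). 1 / u)"
    using assms(2) by (intro sum_mono frac_le) auto
  then have "2 * vol B * (\<Sum>i\<in>UNIV. 1 / side B i) \<le> 2 * vol B * (\<Sum>i\<in>(UNIV::'n set). 1 / u)"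
    using vol_pos[OF assms(1)] by (intro mult_left_mono) auto
  then show ?thesis
    by (simp add: surface_area_def field_simps)
qed

lemma exists_grid_step:
  fixes p :: "nat \<Rightarrow> real"
  assumes "0 < k" "p 0 \<le> t" "t \<le> p k"
  shows "\<exists>j<k. p j \<le> t \<and> t \<le> p (Suc j)"
  using assms
proof (induction k)
  case (Suc k)
  show ?case
  proof (cases "k = 0 \<or> p k < t")
    case True
    then show ?thesis using Suc.prems by (intro exI[of _ k]) auto
  next
    case False
    then show ?thesis using Suc by (auto intro: less_SucI)
  qed
qed simp

text \<open>Cells are labelled by the vector \<open>f\<close> of interval numbers, so that sums over
  cells factor over the coordinates and neighbouring cells have shifted labels.\<close>

definition grid_cell :: "('n \<Rightarrow> nat \<Rightarrow> real) \<Rightarrow> ('n \<Rightarrow> nat) \<Rightarrow> (real ^ 'n) set" where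
  "grid_cell p f = cbox (\<chi> i. p i (f i)) (\<chi> i. p i (Suc (f i)))"

definition grid_index :: "('n::finite \<Rightarrow> nat) \<Rightarrow> ('n \<Rightarrow> nat) set" where
  "grid_index k = {f. \<forall>i. f i < k i}"

lemma grid_index_PiE: "grid_index k = Pi\<^sub>E UNIV (\<lambda>i. {..<k i})"
  by (auto simp: grid_index_def PiE_UNIV_domain)

lemma finite_grid_index [simp]: "finite (grid_index k)"
  by (simp add: grid_index_PiE finite_PiE)

lemma card_grid_index: "card (grid_index k) = (\<Prod>i\<in>UNIV. k i)"
  by (simp add: grid_index_PiE card_PiE)

text \<open>\<open>p i\<close> lists the cut points in direction \<open>i\<close>. The gap
  \<open>u\<close> makes every cell at least \<open>u\<close> wide, which for \<open>U < u\<close>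
  keeps all cells in the domain of a weight with threshold \<open>U\<close>.\<close>

locale grid =
  fixes p :: "'n::finite \<Rightarrow> nat \<Rightarrow> real" and k :: "'n \<Rightarrow> nat" and u :: real
  assumes k_pos: "\<And>i. 0 < k i"
    and u_pos: "0 < u"
    and gap: "\<And>i j. j < k i \<Longrightarrow> p i j + u \<le> p i (Suc j)"
begin

abbreviation "whole \<equiv> cbox (\<chi> i. p i 0) (\<chi> i. p i (k i)) :: (real ^ 'n) set"

lemma mono:
  assumes "j \<le> l" "l \<le> k i"
  shows "p i j \<le> p i l"
  using assms
proof (induction l rule: dec_induct)
  case (step l)
  then show ?case using gap[of l i] u_pos by auto
qed simp

lemma gap_ends: "p i 0 + u \<le> p i (k i)"
  using gap[of 0 i] mono[of 1 "k i" i] k_pos[of i] by auto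

lemma cell_gap: "f \<in> grid_index k \<Longrightarrow> p i (f i) + u \<le> p i (Suc (f i))"
  by (simp add: gap grid_index_def)

lemma cell_less: "f \<in> grid_index k \<Longrightarrow> p i (f i) < p i (Suc (f i))"
  using cell_gap[of f i] u_pos by linarith

lemma ends_less: "p i 0 < p i (k i)"
  using gap_ends[of i] u_pos by linarith

lemma is_box_cell: "f \<in> grid_index k \<Longrightarrow> is_box (grid_cell p f)"
  unfolding grid_cell_def by (rule is_box_cbox) (simp add: cell_less)

lemma vol_cell: "f \<in> grid_index k \<Longrightarrow> vol (grid_cell p f) = (\<Prod>i\<in>UNIV. p i (Suc (f i)) - p i (f i))"
  unfolding grid_cell_def by (subst vol_box) (simp_all add: cell_less)

lemma width_cell: "f \<in> grid_index k \<Longrightarrow> u \<le> width (grid_cell p f)"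
  unfolding grid_cell_def
  by (subst le_width_box) (simp_all add: cell_less cell_gap le_diff_eq add.commute[of u])

lemma is_box_whole: "is_box whole"
  by (rule is_box_cbox) (simp add: ends_less)

lemma vol_whole: "vol whole = (\<Prod>i\<in>UNIV. p i (k i) - p i 0)"
  by (subst vol_box) (simp_all add: ends_less)

lemma width_whole: "u \<le> width whole"
  by (subst le_width_box) (simp_all add: ends_less gap_ends le_diff_eq add.commute[of u])

lemma cell_subset:
  assumes f: "f \<in> grid_index k"
  shows "grid_cell p f \<subseteq> whole"
proof
  fix x assume "x \<in> grid_cell p f"
  then have "p i (f i) \<le> x $ i \<and> x $ i \<le> p i (Suc (f i))" for i
    by (simp add: grid_cell_def mem_box_cart)
  moreover have "p i 0 \<le> p i (f i)" "p i (Suc (f i)) \<le> p i (k i)" for i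
    using f by (auto simp: grid_index_def Suc_le_eq less_imp_le intro!: mono)
  ultimately show "x \<in> whole"
    by (simp add: mem_box_cart) (meson order_trans)
qed

lemma disjoint_cells:
  assumes f: "f \<in> grid_index k" and g: "g \<in> grid_index k" and ne: "f \<noteq> g"
  shows "interior (grid_cell p f) \<inter> interior (grid_cell p g) = {}"
proof -
  have aux: "False" if "f \<in> grid_index k" "g \<in> grid_index k" "f i < g i"
    "x \<in> interior (grid_cell p f)" "x \<in> interior (grid_cell p g)" for f g i x
  proof -
    have "x $ i < p i (Suc (f i))" "p i (g i) < x $ i"
      using that(4,5) by (auto simp: grid_cell_def interior_cbox mem_box_cart)
    moreover have "p i (Suc (f i)) \<le> p i (g i)"
      using that(2,3) by (intro mono) (auto simp: grid_index_def intro: less_imp_le)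
    ultimately show False by linarith
  qed
  obtain i where "f i < g i \<or> g i < f i"
    using ne by (meson ext linorder_neqE_nat)
  then show ?thesis
    using aux[OF f g] aux[OF g f] by blast
qed

lemma interior_cell_nonempty: "f \<in> grid_index k \<Longrightarrow> interior (grid_cell p f) \<noteq> {}"
  unfolding grid_cell_def interior_cbox interval_ne_empty_cart
  by (simp add: cell_less)

lemma inj_on_cell: "inj_on (grid_cell p) (grid_index k)"
  by (rule inj_onI) (metis disjoint_cells interior_cell_nonempty inf.idem)

lemma division: "grid_cell p ` grid_index k division_of whole"
proof (rule division_ofI)
  fix K assume "K \<in> grid_cell p ` grid_index k"
  then obtain f where f: "f \<in> grid_index k" "K = grid_cell p f" by blast
  show "K \<noteq> {}"
    using interior_cell_nonempty[OF f(1)] interior_subset unfolding f(2) by blast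
  show "\<exists>a b. K = cbox a b"
    unfolding f(2) grid_cell_def by blast
  show "K \<subseteq> whole"
    unfolding f(2) by (rule cell_subset[OF f(1)])
next
  fix K1 K2
  assume "K1 \<in> grid_cell p ` grid_index k" "K2 \<in> grid_cell p ` grid_index k" "K1 \<noteq> K2"
  then show "interior K1 \<inter> interior K2 = {}"
    using disjoint_cells by blast
next
  have *: "\<Union> (grid_cell p ` grid_index k) \<supseteq> whole"
  proof
    fix x assume x: "x \<in> whole"
    have "\<exists>j<k i. p i j \<le> x $ i \<and> x $ i \<le> p i (Suc j)" for i
      using x k_pos by (intro exists_grid_step) (auto simp: mem_box_cart)
    then obtain f where "\<And>i. f i < k i \<and> p i (f i) \<le> x $ i \<and> x $ i \<le> p i (Suc (f i))"
      by metis
    then have "f \<in> grid_index k" "x \<in> grid_cell p f"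
      by (auto simp: grid_index_def grid_cell_def mem_box_cart)
    then show "x \<in> \<Union> (grid_cell p ` grid_index k)" by blast
  qed
  show "\<Union> (grid_cell p ` grid_index k) = whole"
    using * cell_subset by blast
qed simp

text \<open>The sum over all labels of a product of side lengths is the product of the coordinate
  sums, and each of these telescopes.\<close>

lemma sum_vol: "(\<Sum>f\<in>grid_index k. vol (grid_cell p f)) = vol whole"
proof -
  have "(\<Sum>f\<in>grid_index k. vol (grid_cell p f)) =
      (\<Sum>f\<in>grid_index k. \<Prod>i\<in>UNIV. p i (Suc (f i)) - p i (f i))"
    by (intro sum.cong refl vol_cell)
  also have "\<dots> = (\<Prod>i\<in>UNIV. \<Sum>j<k i. p i (Suc j) - p i j)"
    unfolding grid_index_PiE by (rule prod_sum_PiE[symmetric]) auto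
  finally show ?thesis
    by (simp add: sum_lessThan_telescope vol_whole)
qed

end

subsection \<open>Approximately additive box functions\<close>

text \<open>Condition (c) of a local weight distribution for a real-valued weight, with explicit
  threshold and constant.\<close>

definition approx_additive :: "real \<Rightarrow> real \<Rightarrow> ((real ^ 'n) set \<Rightarrow> real) \<Rightarrow> bool" where
  "approx_additive U C v \<longleftrightarrow> (\<forall>B \<in> boxes_wider_than U. \<forall>D \<subseteq> boxes_wider_than U.
     D division_of B \<longrightarrow> \<bar>v B - (\<Sum>K\<in>D. v K)\<bar> \<le> C * (\<Sum>K\<in>D. surface_area K))"

text \<open>The volumes of the cells add up exactly, and each surface area is
  \<open>O(1 / u)\<close> times the volume; hence the error does not grow with the number of
  cells.\<close>

lemma (in grid) sum_cells:
  assumes v: "approx_additive U C v" and U: "U < u" and C: "0 \<le> C"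
  shows "\<bar>v whole - (\<Sum>f\<in>grid_index k. v (grid_cell p f))\<bar>
    \<le> 2 * C * real CARD('n) / u * vol whole"
proof -
  let ?D = "grid_cell p ` grid_index k"
  have "whole \<in> boxes_wider_than U"
    using is_box_whole width_whole U by (simp add: boxes_wider_than_def)
  moreover have "?D \<subseteq> boxes_wider_than U"
    using is_box_cell width_cell U by (fastforce simp: boxes_wider_than_def)
  ultimately have "\<bar>v whole - (\<Sum>K\<in>?D. v K)\<bar> \<le> C * (\<Sum>K\<in>?D. surface_area K)"
    using v division unfolding approx_additive_def by blast
  moreover have "(\<Sum>K\<in>?D. surface_area K) \<le> 2 * real CARD('n) / u * vol whole"
  proof -
    have "(\<Sum>K\<in>?D. surface_area K) = (\<Sum>f\<in>grid_index k. surface_area (grid_cell p f))"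
      by (simp add: sum.reindex[OF inj_on_cell])
    also have "\<dots> \<le> (\<Sum>f\<in>grid_index k. 2 * real CARD('n) / u * vol (grid_cell p f))"
      by (intro sum_mono surface_area_le is_box_cell width_cell u_pos)
    finally show ?thesis
      unfolding sum_distrib_left[symmetric] sum_vol .
  qed
  ultimately have "\<bar>v whole - (\<Sum>K\<in>?D. v K)\<bar> \<le> C * (2 * real CARD('n) / u * vol whole)"
    using C by (meson mult_left_mono order_trans)
  then show ?thesis
    by (simp add: sum.reindex[OF inj_on_cell] mult_ac)
qed

abbreviation cube :: "real ^ 'n \<Rightarrow> real \<Rightarrow> (real ^ 'n) set" where
  "cube x u \<equiv> cbox (x - (\<chi> i. u)) (x + (\<chi> i. u))"

lemma inner_box_le:
  fixes e :: "(real ^ 'n) set \<Rightarrow> real"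
  assumes e: "approx_additive U C e" and C: "0 \<le> C" and u: "U < u" "0 < u"
    and nonneg: "\<And>B. is_box B \<Longrightarrow> u \<le> width B \<Longrightarrow> 0 \<le> e B"
    and gaps: "\<And>i. a $ i + u \<le> c $ i" "\<And>i. c $ i + u \<le> d $ i" "\<And>i. d $ i + u \<le> b $ i"
  shows "e (cbox c d) \<le> e (cbox a b) + 2 * C * real CARD('n) / u * vol (cbox a b)"
proof -
  define p :: "'n \<Rightarrow> nat \<Rightarrow> real" where
    "p = (\<lambda>i j. if j = 0 then a $ i else if j = 1 then c $ i else if j = 2 then d $ i else b $ i)"
  interpret grid p "\<lambda>_. 3" u
  proof
    fix i j assume "j < (3::nat)"
    then consider "j = 0" | "j = 1" | "j = 2" by linarith
    then show "p i j + u \<le> p i (Suc j)"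
      using gaps by cases (auto simp: p_def)
  qed (use u in auto)
  have whole: "whole = cbox a b"
    by (simp add: p_def)
  have cell: "grid_cell p (\<lambda>_. 1) = cbox c d"
    by (simp add: p_def grid_cell_def)
  have mem: "(\<lambda>_. 1) \<in> grid_index (\<lambda>_. 3)"
    by (simp add: grid_index_def)
  have "e (grid_cell p (\<lambda>_. 1)) \<le> (\<Sum>f\<in>grid_index (\<lambda>_. 3). e (grid_cell p f))"
    by (rule member_le_sum[OF mem]) (auto intro: nonneg is_box_cell width_cell)
  then show ?thesis
    using sum_cells[OF e u(1) C] unfolding whole cell by linarith
qed

text \<open>Cells have sides \<open>\<tau> i \<ge> 2 * u\<close>, so the cube of half-side
  \<open>u\<close> about a point of a cell stays inside the block of \<open>3^n\<close> cells around
  it, with margin \<open>u\<close>. Cutting out the cube and cutting the block into cells each cost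
  \<open>2 * C\<close>, whence \<open>4 * C\<close>.\<close>

lemma block_bound:
  fixes e :: "(real ^ 'n) set \<Rightarrow> real" and f :: "'n \<Rightarrow> nat"
  assumes e: "approx_additive U C e" and C: "0 \<le> C" and u: "U < u" "0 < u"
    and nonneg: "\<And>B. is_box B \<Longrightarrow> u \<le> width B \<Longrightarrow> 0 \<le> e B"
    and p: "\<And>i j. p i j = a i + \<tau> i * real j" and \<tau>: "\<And>i. 2 * u \<le> \<tau> i"
    and f: "\<And>i. 1 \<le> f i" and x: "x \<in> grid_cell p f"
  shows "e (cube x u) \<le> (\<Sum>g\<in>grid_index (\<lambda>_. 3). e (grid_cell p (\<lambda>i. f i - 1 + g i)))
    + 4 * C * real CARD('n) / u * (\<Prod>i\<in>UNIV. 3 * \<tau> i)"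
proof -
  \<comment> \<open>The cut points of the block. As \<open>1 \<le> f i\<close>, the subtraction on
    naturals is exact and the block starts one cell before \<open>f\<close>.\<close>
  define q where "q = (\<lambda>i j. p i (f i - 1 + j))"
  interpret grid q "\<lambda>_. 3" u
  proof
    fix i j
    show "q i j + u \<le> q i (Suc j)"
      using \<tau>[of i] u by (simp add: q_def p distrib_left)
  qed (use u in auto)
  have cell: "grid_cell q g = grid_cell p (\<lambda>i. f i - 1 + g i)" for g
    by (simp add: grid_cell_def q_def)
  have vol: "vol whole = (\<Prod>i\<in>UNIV. 3 * \<tau> i)"
    unfolding vol_whole by (simp add: q_def p distrib_left mult.commute)
  have x': "p i (f i) \<le> x $ i" "x $ i \<le> p i (Suc (f i))" for i
    using x by (auto simp: grid_cell_def mem_box_cart)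
  have q0: "q i 0 = p i (f i) - \<tau> i" and q3: "q i 3 = p i (Suc (f i)) + \<tau> i" for i
    using f[of i] by (simp_all add: q_def p of_nat_diff algebra_simps)
  have "e (cube x u) \<le> e whole + 2 * C * real CARD('n) / u * vol whole"
  proof (rule inner_box_le[OF e C u nonneg])
    fix i
    show "(\<chi> i. q i 0) $ i + u \<le> (x - (\<chi> i. u)) $ i"
      using x'(1)[of i] \<tau>[of i] q0[of i] by simp
    show "(x + (\<chi> i. u)) $ i + u \<le> (\<chi> i. q i 3) $ i"
      using x'(2)[of i] \<tau>[of i] q3[of i] by simp
  qed (use u in auto)
  also have "e whole \<le> (\<Sum>g\<in>grid_index (\<lambda>_. 3). e (grid_cell q g))
      + 2 * C * real CARD('n) / u * vol whole"
    using sum_cells[OF e u(1) C] by linarith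
  finally show ?thesis
    by (simp add: cell vol)
qed

text \<open>The excess \<open>e\<close> is nonnegative on wide boxes, so the \<open>3^n\<close>-blocks around the grid cells that
  meet \<open>S\<close> may overlap: every cell lies in at most \<open>3^n\<close> of them.\<close>

lemma packing:
  fixes e :: "(real ^ 'n) set \<Rightarrow> real"
  assumes e: "approx_additive U C e" and C: "0 \<le> C" and u: "U < u" "0 < u"
    and nonneg: "\<And>B. is_box B \<Longrightarrow> u \<le> width B \<Longrightarrow> 0 \<le> e B"
    and ab: "\<And>i. 8 * u \<le> b $ i - a $ i"
    and S: "finite S" "\<And>x i. x \<in> S \<Longrightarrow> a $ i + 4 * u \<le> x $ i"
      "\<And>x i. x \<in> S \<Longrightarrow> x $ i + 4 * u \<le> b $ i"
    and \<kappa>: "\<And>c d. (\<And>i. d $ i - c $ i \<le> 4 * u) \<Longrightarrow> real (card (S \<inter> cbox c d)) \<le> \<kappa>"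
    and \<gamma>: "0 \<le> \<gamma>" "\<And>x. x \<in> S \<Longrightarrow> \<gamma> \<le> e (cube x u)"
  shows "\<gamma> * real (card S)
    \<le> \<kappa> * (3 ^ CARD('n) * (e (cbox a b) + 6 * C * real CARD('n) / u * vol (cbox a b)))"
proof -
  \<comment> \<open>Rounding down makes the step \<open>\<tau> i\<close> at least
    \<open>2 * u\<close>, as \<open>block_bound\<close> requires; since the quotient is at least 4,
    the step also stays below \<open>4 * u\<close>, as the bound \<open>\<kappa>\<close>
    requires.\<close>
  define k where "k = (\<lambda>i. nat \<lfloor>(b $ i - a $ i) / (2 * u)\<rfloor>)"
  define \<tau> where "\<tau> = (\<lambda>i. (b $ i - a $ i) / real (k i))"
  define p where "p = (\<lambda>i j. a $ i + \<tau> i * real j)"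
  let ?n = "real CARD('n)"
  have quot: "4 \<le> (b $ i - a $ i) / (2 * u)" for i
    using ab[of i] u by (simp add: field_simps)
  have k: "4 \<le> k i" for i
    using quot[of i] by (simp add: k_def le_nat_iff le_floor_iff)
  have k_le: "real (k i) \<le> (b $ i - a $ i) / (2 * u)" for i
    using quot[of i] by (simp add: k_def)
  have k_gt: "(b $ i - a $ i) / (2 * u) < real (k i) + 1" for i
    using quot[of i] unfolding k_def by linarith
  have \<tau>_ge: "2 * u \<le> \<tau> i" for i
    using k_le[of i] k[of i] u by (simp add: \<tau>_def field_simps)
  have \<tau>_less: "\<tau> i < 4 * u" for i
  proof -
    have "(b $ i - a $ i) / (2 * u) < 2 * real (k i)"
      using k_gt[of i] k[of i] by linarith
    then show ?thesis
      using k[of i] u by (simp add: \<tau>_def field_simps)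
  qed
  have k\<tau>: "real (k i) * \<tau> i = b $ i - a $ i" for i
    using k[of i] by (simp add: \<tau>_def)
  interpret grid p k u
  proof
    show "0 < k i" for i using k[of i] by simp
    show "p i j + u \<le> p i (Suc j)" for i j
      using \<tau>_ge[of i] u by (simp add: p_def distrib_left)
  qed (use u in auto)
  have whole: "whole = cbox a b"
    using k\<tau> by (simp add: p_def mult.commute[of "\<tau> _"])
  \<comment> \<open>The occupied cells with a neighbour on both sides in every direction, so that
    the block around each lies in the grid. Points of \<open>S\<close> keep a distance
    \<open>4 * u > \<tau> i\<close> from the boundary and therefore lie in such cells.\<close>
  define F where
    "F = {f \<in> grid_index k. (\<forall>i. 1 \<le> f i \<and> f i + 1 < k i) \<and> S \<inter> grid_cell p f \<noteq> {}}"
  have finF: "finite F"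
    by (rule finite_subset[OF _ finite_grid_index[of k]]) (auto simp: F_def)
  have cover: "S \<subseteq> (\<Union>f\<in>F. S \<inter> grid_cell p f)"
  proof
    fix x assume x: "x \<in> S"
    define f where "f = (\<lambda>i. nat \<lfloor>(x $ i - a $ i) / \<tau> i\<rfloor>)"
    have f: "1 \<le> f i" "f i + 1 < k i" "p i (f i) \<le> x $ i" "x $ i \<le> p i (Suc (f i))" for i
    proof -
      have pos: "0 < \<tau> i"
        using \<tau>_ge[of i] u by linarith
      have ge: "1 \<le> (x $ i - a $ i) / \<tau> i"
        using S(2)[OF x, of i] \<tau>_less[of i] pos by (simp add: field_simps)
      have "x $ i - a $ i < real (k i) * \<tau> i - \<tau> i"
        using S(3)[OF x, of i] \<tau>_less[of i] k\<tau>[of i] by linarith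
      then have less: "(x $ i - a $ i) / \<tau> i < real (k i) - 1"
        using pos by (simp add: field_simps)
      show f1: "1 \<le> f i"
        using ge by (simp add: f_def le_nat_iff le_floor_iff)
      have le: "real (f i) \<le> (x $ i - a $ i) / \<tau> i"
        using ge by (simp add: f_def)
      have "(x $ i - a $ i) / \<tau> i < real (f i) + 1"
        using ge unfolding f_def by linarith
      then show "x $ i \<le> p i (Suc (f i))"
        using pos by (simp add: p_def field_simps)
      show "p i (f i) \<le> x $ i"
        using le pos by (simp add: p_def field_simps)
      have "real (f i) + 1 < real (k i)"
        using le less by linarith
      then show "f i + 1 < k i" by linarith
    qed
    have "f \<in> F"
      using f x by (auto simp: F_def grid_index_def grid_cell_def mem_box_cart
          intro: Suc_lessD exI[of _ x])
    moreover have "x \<in> grid_cell p f"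
      using f by (simp add: grid_cell_def mem_box_cart)
    ultimately show "x \<in> (\<Union>f\<in>F. S \<inter> grid_cell p f)"
      using x by blast
  qed
  have "card S \<le> card (\<Union>f\<in>F. S \<inter> grid_cell p f)"
    using S(1) finF by (intro card_mono cover) auto
  also have "\<dots> \<le> (\<Sum>f\<in>F. card (S \<inter> grid_cell p f))"
    by (rule card_UN_le[OF finF])
  finally have "real (card S) \<le> (\<Sum>f\<in>F. real (card (S \<inter> grid_cell p f)))"
    by (metis of_nat_le_iff of_nat_sum)
  also have "\<dots> \<le> (\<Sum>f\<in>F. \<kappa>)"
    unfolding grid_cell_def
    by (intro sum_mono \<kappa>) (simp add: p_def distrib_left less_imp_le[OF \<tau>_less])
  finally have card_S: "real (card S) \<le> real (card F) * \<kappa>"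
    by simp
  have \<kappa>0: "0 \<le> \<kappa>"
    using \<kappa>[of 0 0] u by simp
  have e_cell: "0 \<le> e (grid_cell p f)" if "f \<in> grid_index k" for f
    by (intro nonneg is_box_cell width_cell that)
  define E where "E = 4 * C * ?n / u"
  have E: "0 \<le> E" using C u by (simp add: E_def)
  let ?J = "grid_index (\<lambda>_::'n. 3::nat)"
  \<comment> \<open>Every cell in \<open>F\<close> contains a point of \<open>S\<close>, and the
    cube about it has excess at least \<open>\<gamma>\<close>; up to an error, so has the block
    around the cell.\<close>
  have "\<gamma> * real (card F) = (\<Sum>f\<in>F. \<gamma>)"
    by simp
  also have "\<dots> \<le> (\<Sum>f\<in>F. (\<Sum>g\<in>?J. e (grid_cell p (\<lambda>i. f i - 1 + g i))) + E * (\<Prod>i\<in>UNIV. 3 * \<tau> i))"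
  proof (rule sum_mono)
    fix f assume f: "f \<in> F"
    then obtain x where x: "x \<in> S" "x \<in> grid_cell p f"
      unfolding F_def by blast
    have "e (cube x u) \<le> (\<Sum>g\<in>?J. e (grid_cell p (\<lambda>i. f i - 1 + g i))) + E * (\<Prod>i\<in>UNIV. 3 * \<tau> i)"
      unfolding E_def
      by (rule block_bound[OF e C u nonneg _ \<tau>_ge _ x(2)]) (use f in \<open>auto simp: p_def F_def\<close>)
    then show "\<gamma> \<le> (\<Sum>g\<in>?J. e (grid_cell p (\<lambda>i. f i - 1 + g i))) + E * (\<Prod>i\<in>UNIV. 3 * \<tau> i)"
      using \<gamma>(2)[OF x(1)] by linarith
  qed
  also have "\<dots> = (\<Sum>g\<in>?J. \<Sum>f\<in>F. e (grid_cell p (\<lambda>i. f i - 1 + g i)))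
      + E * (real (card F) * (\<Prod>i\<in>UNIV. 3 * \<tau> i))"
    by (simp add: sum.distrib sum.swap[of _ ?J F])
  also have "(\<Sum>g\<in>?J. \<Sum>f\<in>F. e (grid_cell p (\<lambda>i. f i - 1 + g i)))
      \<le> (\<Sum>g\<in>?J. \<Sum>h\<in>grid_index k. e (grid_cell p h))"
  proof (rule sum_mono)
    fix g assume g: "g \<in> ?J"
    let ?h = "\<lambda>f i. f i - 1 + g i"
    \<comment> \<open>For a fixed offset \<open>g\<close> the shifted cells are pairwise different,
      so by nonnegativity their sum is at most the sum over all cells. The \<open>3^n\<close>
      offsets give the overlap factor.\<close>
    have inj: "inj_on ?h F"
    proof (rule inj_onI)
      fix f f' assume "f \<in> F" "f' \<in> F" "?h f = ?h f'"
      then have "1 \<le> f i" "1 \<le> f' i" "f i - 1 + g i = f' i - 1 + g i" for i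
        by (auto simp: F_def dest: fun_cong[where x = i])
      then have "f i = f' i" for i
        by (metis add_right_cancel eq_diff_iff)
      then show "f = f'" by blast
    qed
    have "?h ` F \<subseteq> grid_index k"
    proof (rule image_subsetI)
      fix f assume f: "f \<in> F"
      have "f i - 1 + g i < k i" for i
      proof -
        have "1 \<le> f i" "f i + 1 < k i" "g i < 3"
          using f g by (auto simp: F_def grid_index_def)
        then show ?thesis by linarith
      qed
      then show "?h f \<in> grid_index k"
        by (simp add: grid_index_def)
    qed
    then have "(\<Sum>h\<in>?h ` F. e (grid_cell p h)) \<le> (\<Sum>h\<in>grid_index k. e (grid_cell p h))"
      by (intro sum_mono2) (auto intro: e_cell)
    then show "(\<Sum>f\<in>F. e (grid_cell p (\<lambda>i. f i - 1 + g i))) \<le> (\<Sum>h\<in>grid_index k. e (grid_cell p h))"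
      by (simp only: sum.reindex[OF inj] o_def)
  qed
  also have "(\<Sum>g\<in>?J. \<Sum>h\<in>grid_index k. e (grid_cell p h))
      = 3 ^ CARD('n) * (\<Sum>h\<in>grid_index k. e (grid_cell p h))"
    by (simp add: card_grid_index)
  also have "(\<Sum>h\<in>grid_index k. e (grid_cell p h))
      \<le> e (cbox a b) + 2 * C * ?n / u * vol (cbox a b)"
    using sum_cells[OF e u(1) C] unfolding whole by linarith
  \<comment> \<open>All cells have the same volume, so \<open>card F\<close> blocks of
    \<open>3^n\<close> cells have total volume at most \<open>3^n\<close> times that of the whole
    box.\<close>
  also have "E * (real (card F) * (\<Prod>i\<in>UNIV. 3 * \<tau> i)) \<le> E * (3 ^ CARD('n) * vol (cbox a b))"
  proof (rule mult_left_mono[OF _ E])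
    have "card F \<le> card (grid_index k)"
      by (rule card_mono) (auto simp: F_def)
    moreover have "0 \<le> (\<Prod>i\<in>UNIV. 3 * \<tau> i)"
      by (rule prod_nonneg) (use \<tau>_ge u in \<open>smt (verit)\<close>)
    ultimately have "real (card F) * (\<Prod>i\<in>UNIV. 3 * \<tau> i)
        \<le> real (card (grid_index k)) * (\<Prod>i\<in>UNIV. 3 * \<tau> i)"
      by (intro mult_right_mono) auto
    also have "\<dots> = 3 ^ CARD('n) * (\<Prod>i\<in>UNIV. real (k i) * \<tau> i)"
      by (simp add: card_grid_index prod.distrib)
    also have "\<dots> = 3 ^ CARD('n) * vol (cbox a b)"
      unfolding whole[symmetric] vol_whole by (simp add: p_def mult.commute)
    finally show "real (card F) * (\<Prod>i\<in>UNIV. 3 * \<tau> i) \<le> 3 ^ CARD('n) * vol (cbox a b)" .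
  qed
  \<comment> \<open>The blocks contribute \<open>4 * C\<close> and the division of the whole box
    \<open>2 * C\<close>.\<close>
  finally have "\<gamma> * real (card F)
      \<le> 3 ^ CARD('n) * (e (cbox a b) + 6 * C * ?n / u * vol (cbox a b))"
    by (simp add: E_def algebra_simps)
  then have "\<kappa> * (\<gamma> * real (card F))
      \<le> \<kappa> * (3 ^ CARD('n) * (e (cbox a b) + 6 * C * ?n / u * vol (cbox a b)))"
    by (rule mult_left_mono[OF _ \<kappa>0])
  moreover have "\<gamma> * real (card S) \<le> \<kappa> * (\<gamma> * real (card F))"
    using mult_left_mono[OF card_S \<gamma>(1)] by (simp add: mult_ac)
  ultimately show ?thesis
    by linarith
qed

subsection \<open>Points and patches of a Delone set\<close>

lemma delone_finite_bounded:
  assumes "delone X" "bounded A"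
  shows "finite (X \<inter> A)"
proof -
  obtain m y where "A \<subseteq> cball y m"
    using assms(2) unfolding bounded_subset_cball by blast
  then have "X \<inter> A \<subseteq> X \<inter> cball y m"
    by blast
  then show ?thesis
    by (rule finite_subset) (rule delone_finite_cball[OF assms(1)])
qed

text \<open>A half-open subcube of side \<open>s = r / n\<close> holds at most one point: two would
  be closer than \<open>r\<close> in the l1 norm, hence in the Euclidean norm. It remains to count
  subcubes; \<open>u \<ge> 1\<close> absorbs the rounding.\<close>

lemma delone_card_cbox_le:
  fixes X :: "(real ^ 'n) set"
  assumes "delone X"
  shows "\<exists>\<kappa>>0. \<forall>u\<ge>1. \<forall>c d. (\<forall>i. d $ i - c $ i \<le> 4 * u) \<longrightarrow>
    real (card (X \<inter> cbox c d)) \<le> \<kappa> * u ^ CARD('n)"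
proof -
  obtain r where r: "r > 0" "\<forall>c. \<forall>x \<in> X \<inter> ball c r. \<forall>y \<in> X \<inter> ball c r. x = y"
    using assms by (auto simp: delone_def)
  define s where "s = r / real CARD('n)"
  have s: "s > 0" using r by (simp add: s_def)
  have "real (card (X \<inter> cbox c d)) \<le> (4 / s + 1) ^ CARD('n) * u ^ CARD('n)"
    if u: "u \<ge> 1" and cd: "\<And>i. d $ i - c $ i \<le> 4 * u" for u c d
  proof -
    define h where "h = (\<lambda>x i. nat \<lfloor>(x $ i - c $ i) / s\<rfloor>)"
    let ?G = "grid_index (\<lambda>_::'n. nat \<lfloor>4 * u / s\<rfloor> + 1)"
    have nn: "0 \<le> (x $ i - c $ i) / s" if "x \<in> cbox c d" for x i
      using that s by (simp add: mem_box_cart)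
    have "inj_on h (X \<inter> cbox c d)"
    proof (rule inj_onI)
      fix x y assume xy: "x \<in> X \<inter> cbox c d" "y \<in> X \<inter> cbox c d" "h x = h y"
      have "\<bar>x $ i - y $ i\<bar> < s" for i
      proof -
        have "\<lfloor>(x $ i - c $ i) / s\<rfloor> = \<lfloor>(y $ i - c $ i) / s\<rfloor>"
          using fun_cong[OF xy(3), of i] nn[of x i] nn[of y i] xy(1,2) unfolding h_def
          by (metis IntD2 eq_nat_nat_iff zero_le_floor)
        then have "\<bar>(x $ i - c $ i) / s - (y $ i - c $ i) / s\<bar> < 1"
          by linarith
        then show ?thesis
          using s by (simp add: diff_divide_distrib[symmetric])
      qed
      then have "(\<Sum>i\<in>UNIV. \<bar>(x - y) $ i\<bar>) < (\<Sum>i\<in>(UNIV::'n set). s)"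
        by (intro sum_strict_mono) auto
      then have "norm (x - y) < r"
        using norm_le_l1_cart[of "x - y"] by (simp add: s_def)
      then have "x \<in> X \<inter> ball x r" "y \<in> X \<inter> ball x r"
        using xy r by (auto simp: dist_norm)
      then show "x = y" using r(2) by blast
    qed
    moreover have "h ` (X \<inter> cbox c d) \<subseteq> ?G"
    proof (rule image_subsetI)
      fix x assume x: "x \<in> X \<inter> cbox c d"
      have "(x $ i - c $ i) / s \<le> 4 * u / s" for i
      proof (rule divide_right_mono)
        have "x $ i \<le> d $ i"
          using x by (simp add: mem_box_cart)
        then show "x $ i - c $ i \<le> 4 * u"
          using cd[of i] by linarith
      qed (use s in simp)
      then have "h x i \<le> nat \<lfloor>4 * u / s\<rfloor>" for i
        unfolding h_def by (intro nat_mono floor_mono)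
      then show "h x \<in> ?G"
        by (simp add: grid_index_def less_Suc_eq_le)
    qed
    ultimately have "card (X \<inter> cbox c d) \<le> card ?G"
      by (rule card_inj_on_le) simp
    then have "real (card (X \<inter> cbox c d)) \<le> real (card ?G)"
      by simp
    also have "\<dots> = (real (nat \<lfloor>4 * u / s\<rfloor>) + 1) ^ CARD('n)"
      by (simp add: card_grid_index add.commute)
    also have "\<dots> \<le> ((4 / s + 1) * u) ^ CARD('n)"
    proof (rule power_mono)
      have "real (nat \<lfloor>4 * u / s\<rfloor>) \<le> 4 * u / s"
        using u s by simp
      then show "real (nat \<lfloor>4 * u / s\<rfloor>) + 1 \<le> (4 / s + 1) * u"
        using u by (simp add: distrib_right)
    qed simp
    finally show ?thesis
      by (simp add: power_mult_distrib)
  qed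
  moreover have "(4 / s + 1) ^ CARD('n) > 0"
    using s by (intro zero_less_power add_pos_pos) auto
  ultimately show ?thesis by blast
qed

text \<open>The box contains non-overlapping cubes of side \<open>3 * M\<close>, and the ball of
  radius \<open>M\<close> about the centre of each contains an occurrence of every patch in
  \<open>P\<close>. Different patches or different cubes give different points.\<close>

lemma card_occurrences_ge:
  fixes X :: "(real ^ 'n) set"
  assumes X: "delone X" and M: "repetitivity_radius X T M" and P: "P \<subseteq> patch X T ` X"
    and cd: "\<And>i. 3 * M \<le> d $ i - c $ i"
  shows "real (card P) * (\<Prod>i\<in>UNIV. (d $ i - c $ i) / (6 * M))
    \<le> real (card {x \<in> X \<inter> cbox c d. patch X T x \<in> P})" (is "_ \<le> real (card ?S)")
proof -
  have M0: "M > 0" using M by (simp add: repetitivity_radius_def)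
  define k where "k = (\<lambda>i. nat \<lfloor>(d $ i - c $ i) / (3 * M)\<rfloor>)"
  have quot: "1 \<le> (d $ i - c $ i) / (3 * M)" for i
    using cd[of i] M0 by (simp add: field_simps)
  have k1: "1 \<le> k i" for i
    using quot[of i] by (simp add: k_def le_nat_iff le_floor_iff)
  have k_le: "real (k i) * (3 * M) \<le> d $ i - c $ i" for i
  proof -
    have "real (k i) \<le> (d $ i - c $ i) / (3 * M)"
      using quot[of i] by (simp add: k_def)
    then show ?thesis using M0 by (simp add: field_simps)
  qed
  \<comment> \<open>Rounding down a number that is at least 1 loses at most half of it, whence
    \<open>6 * M\<close> in place of \<open>3 * M\<close>.\<close>
  have k_ge: "(d $ i - c $ i) / (6 * M) \<le> real (k i)" for i
  proof -
    have "(d $ i - c $ i) / (3 * M) < real (k i) + 1"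
      using quot[of i] unfolding k_def by linarith
    also have "\<dots> \<le> 2 * real (k i)"
      using k1[of i] by simp
    finally show ?thesis using M0 by (simp add: field_simps)
  qed
  \<comment> \<open>The centre of the cube with label \<open>g\<close>. Different centres differ by
    at least \<open>3 * M > 2 * M\<close> in some coordinate, so the balls of radius
    \<open>M\<close> are disjoint.\<close>
  define z where "z = (\<lambda>g. \<chi> i. c $ i + 3 * M * (real (g i) + 1 / 2))"
  have "\<exists>x. x \<in> X \<inter> cball (z g) M \<and> patch X T x = q" if "q \<in> P" for q g
  proof -
    obtain y where "y \<in> X" "q = patch X T y"
      using P \<open>q \<in> P\<close> by blast
    then show ?thesis
      using M unfolding repetitivity_radius_def by blast
  qed
  then obtain \<phi> where \<phi>: "\<And>q g. q \<in> P \<Longrightarrow> \<phi> q g \<in> X \<inter> cball (z g) M \<and> patch X T (\<phi> q g) = q"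
    by metis
  have near: "\<bar>\<phi> q g $ i - z g $ i\<bar> \<le> M" if "q \<in> P" for q g i
    using \<phi>[OF that, of g] component_le_norm_cart[of "\<phi> q g - z g" i]
    by (auto simp: dist_norm norm_minus_commute)
  have "inj_on (\<lambda>(q, g). \<phi> q g) (P \<times> grid_index k)"
  proof (rule inj_onI, clarify)
    fix q g q' g'
    assume q: "q \<in> P" "q' \<in> P" and eq: "\<phi> q g = \<phi> q' g'"
    have "q = q'"
      using \<phi>[OF q(1), of g] \<phi>[OF q(2), of g'] eq by metis
    moreover have "g i = g' i" for i
    proof -
      have "\<bar>z g $ i - z g' $ i\<bar> \<le> 2 * M"
        using near[OF q(1), of g i] near[OF q(2), of g' i] unfolding eq by linarith
      moreover have "z g $ i - z g' $ i = M * (3 * (real (g i) - real (g' i)))"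
        by (simp add: z_def algebra_simps)
      ultimately have "M * \<bar>3 * (real (g i) - real (g' i))\<bar> \<le> M * 2"
        using M0 by (simp add: abs_mult)
      then have "\<bar>3 * (real (g i) - real (g' i))\<bar> \<le> 2"
        using M0 by (simp only: mult_le_cancel_left_pos)
      then have "\<bar>real (g i) - real (g' i)\<bar> < 1"
        by (simp add: abs_mult)
      then show ?thesis by linarith
    qed
    ultimately show "q = q' \<and> g = g'" by (simp add: fun_eq_iff)
  qed
  moreover have "(\<lambda>(q, g). \<phi> q g) ` (P \<times> grid_index k) \<subseteq> ?S"
  proof (rule image_subsetI, clarify)
    fix q g assume q: "q \<in> P" and g: "g \<in> grid_index k"
    have "c $ i \<le> \<phi> q g $ i \<and> \<phi> q g $ i \<le> d $ i" for i
    proof -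
      have "real (g i) + 1 \<le> real (k i)"
        using g by (simp add: grid_index_def nat_less_real_le)
      then have "(real (g i) + 1) * (3 * M) \<le> real (k i) * (3 * M)"
        using M0 by (intro mult_right_mono) auto
      then have "3 * (M * real (g i)) + 3 * M \<le> real (k i) * (3 * M)"
        by (simp add: algebra_simps)
      moreover have "0 \<le> M * real (g i)"
        using M0 by simp
      moreover have "z g $ i = c $ i + 3 * (M * real (g i)) + 3 / 2 * M"
        by (simp add: z_def algebra_simps)
      ultimately show ?thesis
        using near[OF q, of g i] k_le[of i] M0 by linarith
    qed
    then show "\<phi> q g \<in> X \<inter> cbox c d \<and> patch X T (\<phi> q g) \<in> P"
      using \<phi>[OF q, of g] q by (simp add: mem_box_cart)
  qed
  moreover have "finite ?S"
    using delone_finite_bounded[OF X bounded_cbox] by (rule rev_finite_subset) auto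
  ultimately have "card (P \<times> grid_index k) \<le> card ?S"
    by (rule card_inj_on_le)
  then have "real (card P) * (\<Prod>i\<in>UNIV. real (k i)) \<le> real (card ?S)"
    by (simp add: card_cartesian_product card_grid_index flip: of_nat_prod of_nat_mult)
  moreover have "(\<Prod>i\<in>UNIV. (d $ i - c $ i) / (6 * M)) \<le> (\<Prod>i\<in>UNIV. real (k i))"
  proof (rule prod_mono)
    fix i
    have "0 \<le> (d $ i - c $ i) / (6 * M)"
      using cd[of i] M0 by simp
    then show "0 \<le> (d $ i - c $ i) / (6 * M) \<and> (d $ i - c $ i) / (6 * M) \<le> real (k i)"
      using k_ge by blast
  qed
  ultimately show ?thesis
    by (meson mult_left_mono of_nat_0_le_iff order_trans)
qed

section \<open>Equal patches and translated cubes\<close>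

lemma mem_patch_iff: "z \<in> patch X T x \<longleftrightarrow> x + z \<in> X \<and> norm z \<le> T"
proof
  assume "x + z \<in> X \<and> norm z \<le> T"
  then have "z = x + z - x" "x + z \<in> X \<inter> cball x T"
    by (auto simp: dist_norm)
  then show "z \<in> patch X T x"
    unfolding patch_def by blast
qed (auto simp: patch_def dist_norm norm_minus_commute)

lemma translate_cube: "(+) (x - y) ` cube y u = cube x u"
  by (subst cbox_translation[symmetric]) (simp add: algebra_simps)

text \<open>The l1 norm bounds the Euclidean norm. This is why patches of radius
  \<open>n * u\<close> go with cubes of half-side \<open>u\<close>.\<close>

lemma cube_subset_cball:
  fixes x :: "real ^ 'n"
  shows "cube x u \<subseteq> cball x (real CARD('n) * u)"
proof
  fix z assume "z \<in> cube x u"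
  then have "\<bar>(z - x) $ i\<bar> \<le> u" for i
    by (simp add: mem_box_cart abs_le_iff algebra_simps)
  then have "(\<Sum>i\<in>UNIV. \<bar>(z - x) $ i\<bar>) \<le> real CARD('n) * u"
    using sum_bounded_above[of UNIV "\<lambda>i. \<bar>(z - x) $ i\<bar>" u] by simp
  then show "z \<in> cball x (real CARD('n) * u)"
    using norm_le_l1_cart[of "z - x"] by (simp add: dist_norm norm_minus_commute)
qed

text \<open>The patch at \<open>y\<close> records which points of the cube about \<open>y\<close>
  lie in \<open>X\<close>, and the patch at \<open>x\<close> does so for the translated cube. The
  conclusion is the premise of locality condition (b).\<close>

lemma cube_translation_cong:
  fixes X :: "(real ^ 'n) set"
  assumes eq: "patch X (real CARD('n) * u) x = patch X (real CARD('n) * u) y"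
  shows "(+) (x - y) ` cube y u \<inter> X = (+) (x - y) ` (cube y u \<inter> X)"
proof -
  have "x - y + z \<in> X \<longleftrightarrow> z \<in> X" if "z \<in> cube y u" for z
  proof -
    have "norm (z - y) \<le> real CARD('n) * u"
      using that cube_subset_cball[of y u] by (auto simp: dist_norm norm_minus_commute)
    then show ?thesis
      using mem_patch_iff[of "z - y" X "real CARD('n) * u" x]
        mem_patch_iff[of "z - y" X "real CARD('n) * u" y] eq
      by (simp add: algebra_simps)
  qed
  then show ?thesis by auto
qed

subsection \<open>Improving a lower density bound\<close>

lemma surface_area_nonneg:
  assumes "is_box B"
  shows "0 \<le> surface_area B"
proof -
  have "0 < side B i" for i
    using assms by (auto simp: is_box_def side_cbox)
  then show ?thesis
    using vol_pos[OF assms] unfolding surface_area_def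
    by (intro mult_nonneg_nonneg sum_nonneg) (auto intro: less_imp_le)
qed

lemma vol_eq_measure: "is_box B \<Longrightarrow> vol B = measure lborel B"
  by (auto simp: is_box_def vol_cbox)

lemma sum_vol_division:
  assumes "is_box B" "D division_of B" "\<And>K. K \<in> D \<Longrightarrow> is_box K"
  shows "(\<Sum>K\<in>D. vol K) = vol B"
proof -
  obtain a b where B: "B = cbox a b" using assms(1) by (auto simp: is_box_def)
  have "(\<Sum>K\<in>D. vol K) = sum (measure lborel) D"
    by (intro sum.cong refl vol_eq_measure assms(3))
  then show ?thesis
    using additive_content_division[of D a b] assms(1,2) by (simp add: B vol_eq_measure)
qed

text \<open>Volume is exactly additive over a division, so its multiple cancels. The excess over a
  lower density bound \<open>\<alpha>\<close> is the nonnegative function to which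
  \<open>packing\<close> is applied.\<close>

lemma approx_additive_excess:
  fixes v :: "(real ^ 'n) set \<Rightarrow> real"
  assumes "approx_additive U C v"
  shows "approx_additive U C (\<lambda>B. v B - \<alpha> * vol B)"
  unfolding approx_additive_def
proof (intro ballI allI impI)
  fix B :: "(real ^ 'n) set" and D
  assume B: "B \<in> boxes_wider_than U" and D: "D \<subseteq> boxes_wider_than U" "D division_of B"
  have "(\<Sum>K\<in>D. vol K) = vol B"
    using B D by (intro sum_vol_division) (auto simp: boxes_wider_than_def)
  then have "v B - \<alpha> * vol B - (\<Sum>K\<in>D. v K - \<alpha> * vol K) = v B - (\<Sum>K\<in>D. v K)"
    by (simp add: sum_subtractf flip: sum_distrib_left)
  then show "\<bar>v B - \<alpha> * vol B - (\<Sum>K\<in>D. v K - \<alpha> * vol K)\<bar> \<le> C * (\<Sum>K\<in>D. surface_area K)"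
    using assms B D unfolding approx_additive_def by metis
qed

lemma approx_additive_uminus:
  "approx_additive U C v \<Longrightarrow> approx_additive U C (\<lambda>B. - v B)"
  unfolding approx_additive_def by (simp add: sum_negf abs_minus_commute)

text \<open>Condition (b) of a local weight distribution for a real-valued weight.\<close>

definition approx_local ::
    "(real ^ 'n) set \<Rightarrow> real \<Rightarrow> real \<Rightarrow> ((real ^ 'n) set \<Rightarrow> real) \<Rightarrow> bool" where
  "approx_local X U C v \<longleftrightarrow> (\<forall>B \<in> boxes_wider_than U. \<forall>t.
     (+) t ` B \<inter> X = (+) t ` (B \<inter> X) \<longrightarrow> \<bar>v ((+) t ` B) - v B\<bar> \<le> C * surface_area B)"

lemma approx_local_uminus: "approx_local X U C v \<Longrightarrow> approx_local X U C (\<lambda>B. - v B)"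
  unfolding approx_local_def by (simp add: abs_minus_commute)

lemma cube_box:
  fixes x :: "real ^ 'n"
  assumes "0 < u"
  shows "is_box (cube x u)" "vol (cube x u) = (2 * u) ^ CARD('n)" "2 * u \<le> width (cube x u)"
proof -
  have *: "(x - (\<chi> i. u)) $ i < (x + (\<chi> i. u)) $ i" for i
    using assms by simp
  show "is_box (cube x u)" by (rule is_box_cbox[OF *])
  show "vol (cube x u) = (2 * u) ^ CARD('n)" by (subst vol_box[OF *]) simp
  show "2 * u \<le> width (cube x u)" by (subst le_width_box[OF *]) simp
qed

text \<open>Equal patches make locality applicable to the two cubes. All sides are
  \<open>2 * u\<close>, which bounds the surface area by \<open>n / u\<close> times the
  volume.\<close>

lemma cube_weight_ge:
  fixes X :: "(real ^ 'n) set"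
  assumes v: "approx_local X U C v" and C: "0 \<le> C" and u: "U < u" "0 < u"
    and eq: "patch X (real CARD('n) * u) x = patch X (real CARD('n) * u) y"
  shows "v (cube y u) - C * real CARD('n) / u * (2 * u) ^ CARD('n) \<le> v (cube x u)"
proof -
  note box = cube_box[OF u(2), of y]
  have "cube y u \<in> boxes_wider_than U"
    using box u by (simp add: boxes_wider_than_def)
  then have "\<bar>v ((+) (x - y) ` cube y u) - v (cube y u)\<bar> \<le> C * surface_area (cube y u)"
    using v cube_translation_cong[OF eq] unfolding approx_local_def by blast
  moreover have "surface_area (cube y u) \<le> 2 * real CARD('n) / (2 * u) * vol (cube y u)"
    using box u by (intro surface_area_le) auto
  then have "C * surface_area (cube y u) \<le> C * (real CARD('n) / u * (2 * u) ^ CARD('n))"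
    using C by (intro mult_left_mono) (simp_all add: box(2))
  ultimately show ?thesis
    unfolding translate_cube by (simp add: abs_le_iff)
qed

text \<open>The \<open>O\<close>-bound raised to the power \<open>n\<close>: in this form the patch
  count is compared directly with the volume of a cube of side \<open>M\<close>.\<close>

lemma densely_repetitive_radius:
  fixes X :: "(real ^ 'n) set"
  assumes X: "delone X" "densely_repetitive X"
  obtains C T0 where "C > 0" "T0 > 0"
    "\<And>T. T \<ge> T0 \<Longrightarrow> \<exists>M>0. repetitivity_radius X T M \<and>
      M ^ CARD('n) \<le> C ^ CARD('n) * real (patch_count X T)"
proof -
  let ?n = "CARD('n)"
  have rep: "repetitive X" and
    O: "repetitivity_function X \<in> O[at_top](\<lambda>T. real (patch_count X T) powr (1 / real ?n))"
    using X(2) by (auto simp: densely_repetitive_def)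
  obtain C where C: "C > 0" and "eventually (\<lambda>T. norm (repetitivity_function X T)
      \<le> C * norm (real (patch_count X T) powr (1 / real ?n))) at_top"
    using landau_o.bigE[OF O] by blast
  then obtain T1 where T1: "\<And>T. T \<ge> T1 \<Longrightarrow> \<bar>repetitivity_function X T\<bar>
      \<le> C * (real (patch_count X T) powr (1 / real ?n))"
    by (auto simp: eventually_at_top_linorder)
  show thesis
  proof (rule that[OF C])
    \<comment> \<open>The bound 1 keeps \<open>T\<close> positive, as the existence of the least
      radius requires.\<close>
    fix T assume T: "T \<ge> max 1 T1"
    define M where "M = repetitivity_function X T"
    have M: "repetitivity_radius X T M"
      unfolding M_def using T by (intro repetitivity_function X(1) rep) auto
    have M0: "M > 0"
      using M by (simp add: repetitivity_radius_def)
    have "M \<le> C * (real (patch_count X T) powr (1 / real ?n))"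
      using T1[of T] T by (simp add: M_def)
    then have "M ^ ?n \<le> (C * (real (patch_count X T) powr (1 / real ?n))) ^ ?n"
      using M0 by (intro power_mono) auto
    also have "(real (patch_count X T) powr (1 / real ?n)) ^ ?n = real (patch_count X T)"
      by (cases "patch_count X T = 0") (simp_all add: powr_powr flip: powr_realpow)
    then have "(C * (real (patch_count X T) powr (1 / real ?n))) ^ ?n
        = C ^ ?n * real (patch_count X T)"
      by (simp add: power_mult_distrib)
    finally show "\<exists>M>0. repetitivity_radius X T M \<and> M ^ ?n \<le> C ^ ?n * real (patch_count X T)"
      using M M0 by blast
  qed simp
qed

text \<open>If the points of \<open>Y\<close> account for half of all patches, dense repetitivity
  makes their rich cubes fill a fixed proportion of every wide box, which raises the lower bound
  \<open>\<alpha>\<close>. The constants \<open>c\<close> and \<open>E\<close> are fixed before the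
  weight and the scale, so they serve both \<open>v\<close> and \<open>- v\<close> at every large
  \<open>u\<close>.\<close>

lemma density_improvement:
  fixes X :: "(real ^ 'n) set"
  assumes X: "delone X" "densely_repetitive X" and Cb: "0 \<le> Cb" and Cc: "0 \<le> Cc"
  obtains c E u0 where "c > 0" "u0 > 0"
    "\<And>U v u \<alpha> \<beta> Y. approx_local X U Cb v \<Longrightarrow> approx_additive U Cc v \<Longrightarrow> U < u \<Longrightarrow> u0 \<le> u \<Longrightarrow>
      (\<And>B. is_box B \<Longrightarrow> u \<le> width B \<Longrightarrow> \<alpha> * vol B \<le> v B) \<Longrightarrow>
      Y \<subseteq> X \<Longrightarrow> (\<And>y. y \<in> Y \<Longrightarrow> \<beta> * vol (cube y u) \<le> v (cube y u)) \<Longrightarrow>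
      patch_count X (real CARD('n) * u) \<le> 2 * card (patch X (real CARD('n) * u) ` Y) \<Longrightarrow>
      \<exists>W. \<forall>B. is_box B \<and> W \<le> width B \<longrightarrow> (\<alpha> + c * (\<beta> - \<alpha>) - E / u) * vol B \<le> v B"
proof -
  let ?n = "CARD('n)"
  obtain \<kappa> where \<kappa>: "\<kappa> > 0" "\<And>u c d. u \<ge> 1 \<Longrightarrow> (\<And>i. d $ i - c $ i \<le> 4 * u) \<Longrightarrow>
      real (card (X \<inter> cbox c d)) \<le> \<kappa> * u ^ ?n"
    using delone_card_cbox_le[OF X(1)] by blast
  obtain C T0 where C: "C > 0" and T0: "T0 > 0" and rad: "\<And>T. T \<ge> T0 \<Longrightarrow>
      \<exists>M>0. repetitivity_radius X T M \<and> M ^ ?n \<le> C ^ ?n * real (patch_count X T)"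
    using densely_repetitive_radius[OF X] by blast
  \<comment> \<open>A lower bound for the number of rich points per unit volume: from
    \<open>M^n \<le> C^n * N\<close> and \<open>N \<le> 2 * card P\<close>, with \<open>N\<close>
    the patch count, \<open>card P / (12 * M)^n\<close> is at least \<open>q\<close>.\<close>
  define q where "q = 1 / (2 * (12 * C) ^ ?n)"
  have q: "q > 0" using C by (simp add: q_def)
  \<comment> \<open>Each rich cube contributes \<open>\<delta> * (2 * u)^n\<close>, while
    \<open>packing\<close> costs the factors \<open>\<kappa> * u^n\<close> and \<open>3^n\<close>.
    The powers of \<open>u\<close> cancel.\<close>
  define c where "c = 2 ^ ?n * q / (\<kappa> * 3 ^ ?n)"
  have c: "c > 0" using q \<kappa>(1) by (simp add: c_def)
  \<comment> \<open>The first term comes from comparing cubes with equal patches, the second from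
    the additivity errors in \<open>packing\<close>.\<close>
  define E where "E = c * (Cb * real ?n) + 6 * Cc * real ?n"
  show thesis
  proof (rule that[OF c, of "max 1 T0" E])
    fix U v u \<alpha> \<beta> Y
    assume loc: "approx_local X U Cb v" and add: "approx_additive U Cc v"
      and u: "U < u" "max 1 T0 \<le> u"
      and low: "\<And>B. is_box B \<Longrightarrow> u \<le> width B \<Longrightarrow> \<alpha> * vol B \<le> v B"
      and Y: "Y \<subseteq> X" "\<And>y. y \<in> Y \<Longrightarrow> \<beta> * vol (cube y u) \<le> v (cube y u)"
      and half: "patch_count X (real ?n * u) \<le> 2 * card (patch X (real ?n * u) ` Y)"
    define T where "T = real ?n * u"
    have u1: "u \<ge> 1" "u > 0" using u by auto
    have "1 * u \<le> T"
      unfolding T_def using u1 by (intro mult_right_mono) (auto simp: Suc_le_eq)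
    then have "T \<ge> T0" using u by simp
    then obtain M where M: "M > 0" "repetitivity_radius X T M"
      "M ^ ?n \<le> C ^ ?n * real (patch_count X T)"
      using rad by blast
    define P where "P = patch X T ` Y"
    \<comment> \<open>The excess density guaranteed for the cube about every occurrence of a patch
      in \<open>P\<close>.\<close>
    define \<delta> where "\<delta> = \<beta> - \<alpha> - Cb * real ?n / u"
    let ?e = "\<lambda>B. v B - \<alpha> * vol B"
    \<comment> \<open>Width \<open>16 * u\<close> allows margins of \<open>4 * u\<close> on both
      sides while half of each side remains; width \<open>6 * M\<close> makes that half at least
      \<open>3 * M\<close>, as \<open>card_occurrences_ge\<close> requires.\<close>
    have main: "(\<alpha> + c * (\<beta> - \<alpha>) - E / u) * vol B \<le> v B"
      if B: "is_box B" "max (16 * u) (6 * M) \<le> width B" for B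
    proof -
      obtain a b where ab: "\<And>i. a $ i < b $ i" and Bab: "B = cbox a b"
        using B(1) by (auto simp: is_box_def)
      have side: "16 * u \<le> b $ i - a $ i" "6 * M \<le> b $ i - a $ i" for i
        using B(2) le_width_box[OF ab, of "max (16 * u) (6 * M)"] by (auto simp: Bab)
      have volB: "vol B > 0" by (rule vol_pos[OF B(1)])
      have lowB: "\<alpha> * vol B \<le> v B"
        by (rule low[OF B(1)]) (use B(2) u1 in auto)
      have "c * \<delta> * vol B \<le> ?e B + 6 * Cc * real ?n / u * vol B"
      proof (cases "\<delta> \<ge> 0")
        case False
        then have "c * \<delta> * vol B \<le> 0"
          using c volB by (intro mult_nonpos_nonneg mult_nonneg_nonpos) auto
        moreover have "0 \<le> 6 * Cc * real ?n / u * vol B"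
          using Cc volB u1 by (intro mult_nonneg_nonneg divide_nonneg_nonneg) auto
        ultimately show ?thesis using lowB by linarith
      next
        case True
        define l where "l = a + (\<chi> i. 4 * u)"
        define r where "r = b - (\<chi> i. 4 * u)"
        define S where "S = {x \<in> X \<inter> cbox l r. patch X T x \<in> P}"
        have lr: "r $ i - l $ i \<ge> (b $ i - a $ i) / 2" for i
          using side(1)[of i] by (simp add: l_def r_def)
        have "real (card P) * (\<Prod>i\<in>UNIV. (r $ i - l $ i) / (6 * M)) \<le> real (card S)"
          unfolding S_def
        proof (rule card_occurrences_ge[OF X(1) M(2)])
          show "P \<subseteq> patch X T ` X"
            using Y(1) by (auto simp: P_def)
          show "3 * M \<le> r $ i - l $ i" for i
            using lr[of i] side(2)[of i] by simp
        qed
        moreover have "vol B / (12 * M) ^ ?n \<le> (\<Prod>i\<in>UNIV. (r $ i - l $ i) / (6 * M))"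
        proof -
          have "vol B / (12 * M) ^ ?n = (\<Prod>i\<in>UNIV. (b $ i - a $ i) / (12 * M))"
            by (simp add: Bab vol_box[OF ab] prod_dividef)
          also have "\<dots> \<le> (\<Prod>i\<in>UNIV. (r $ i - l $ i) / (6 * M))"
          proof (rule prod_mono)
            fix i
            have "(b $ i - a $ i) / (12 * M) = (b $ i - a $ i) / 2 / (6 * M)"
              by simp
            also have "\<dots> \<le> (r $ i - l $ i) / (6 * M)"
              using lr[of i] M(1) by (intro divide_right_mono) auto
            finally show "0 \<le> (b $ i - a $ i) / (12 * M) \<and>
                (b $ i - a $ i) / (12 * M) \<le> (r $ i - l $ i) / (6 * M)"
              using ab[of i] M(1) by simp
          qed
          finally show ?thesis .
        qed
        ultimately have "real (card P) * (vol B / (12 * M) ^ ?n) \<le> real (card S)"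
          by (meson mult_left_mono of_nat_0_le_iff order_trans)
        moreover have "q * vol B \<le> real (card P) * (vol B / (12 * M) ^ ?n)"
        proof -
          have "M ^ ?n \<le> C ^ ?n * (2 * real (card P))"
            using half C by (intro order_trans[OF M(3)] mult_left_mono) (auto simp: P_def T_def)
          then have "(12 * M) ^ ?n \<le> 2 * (12 * C) ^ ?n * real (card P)"
            by (simp add: power_mult_distrib)
          then have "q * (12 * M) ^ ?n \<le> real (card P)"
            using C by (simp add: q_def divide_le_eq mult_ac)
          then have "q * (12 * M) ^ ?n * (vol B / (12 * M) ^ ?n)
              \<le> real (card P) * (vol B / (12 * M) ^ ?n)"
            using volB M(1) by (intro mult_right_mono) auto
          then show ?thesis using M(1) by simp
        qed
        ultimately have card_S: "q * vol B \<le> real (card S)"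
          by linarith
        have "\<delta> * (2 * u) ^ ?n * real (card S) \<le> \<kappa> * u ^ ?n *
            (3 ^ ?n * (?e (cbox a b) + 6 * Cc * real ?n / u * vol (cbox a b)))"
        proof (rule packing[OF approx_additive_excess[OF add] Cc u(1) u1(2)])
          show "0 \<le> v B - \<alpha> * vol B" if "is_box B" "u \<le> width B" for B
            using low[OF that] by simp
          show "8 * u \<le> b $ i - a $ i" for i
            using side(1)[of i] u1 by linarith
          show finS: "finite S"
            using delone_finite_bounded[OF X(1) bounded_cbox]
            by (rule rev_finite_subset) (auto simp: S_def)
          show "a $ i + 4 * u \<le> x $ i" "x $ i + 4 * u \<le> b $ i" if "x \<in> S" for x i
          proof -
            have "l $ i \<le> x $ i \<and> x $ i \<le> r $ i"
              using that by (simp add: S_def mem_box_cart)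
            then show "a $ i + 4 * u \<le> x $ i" "x $ i + 4 * u \<le> b $ i"
              by (simp_all add: l_def r_def)
          qed
          show "real (card (S \<inter> cbox c d)) \<le> \<kappa> * u ^ ?n"
            if "\<And>i. d $ i - c $ i \<le> 4 * u" for c d
          proof -
            have "card (S \<inter> cbox c d) \<le> card (X \<inter> cbox c d)"
              by (rule card_mono[OF delone_finite_bounded[OF X(1) bounded_cbox]])
                (auto simp: S_def)
            then show ?thesis
              using \<kappa>(2)[of u d c, OF u1(1) that] by linarith
          qed
          show "0 \<le> \<delta> * (2 * u) ^ ?n"
            using True u1 by simp
          show "\<delta> * (2 * u) ^ ?n \<le> v (cube x u) - \<alpha> * vol (cube x u)" if "x \<in> S" for x
          proof -
            obtain y where y: "y \<in> Y" "patch X T x = patch X T y"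
              using \<open>x \<in> S\<close> by (auto simp: S_def P_def)
            have "v (cube y u) - Cb * real ?n / u * (2 * u) ^ ?n \<le> v (cube x u)"
              using cube_weight_ge[OF loc Cb u(1) u1(2)] y(2) by (simp add: T_def)
            then show ?thesis
              using Y(2)[OF y(1)] unfolding cube_box(2)[OF u1(2)] \<delta>_def
              by (simp add: left_diff_distrib)
          qed
        qed
        moreover have "\<delta> * (2 * u) ^ ?n * (q * vol B) \<le> \<delta> * (2 * u) ^ ?n * real (card S)"
          using True u1 by (intro mult_left_mono[OF card_S]) auto
        ultimately have "u ^ ?n * (2 ^ ?n * q * \<delta> * vol B)
            \<le> u ^ ?n * (\<kappa> * 3 ^ ?n * (?e B + 6 * Cc * real ?n / u * vol B))"
          by (simp add: Bab power_mult_distrib mult_ac)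
        then have "2 ^ ?n * q * \<delta> * vol B \<le> \<kappa> * 3 ^ ?n * (?e B + 6 * Cc * real ?n / u * vol B)"
          using u1 by (simp only: mult_le_cancel_left_pos zero_less_power)
        then have "2 ^ ?n * q * \<delta> * vol B / (\<kappa> * 3 ^ ?n) \<le> ?e B + 6 * Cc * real ?n / u * vol B"
          using \<kappa>(1) by (simp add: pos_divide_le_eq mult.commute)
        then show ?thesis
          by (simp add: c_def)
      qed
      then show ?thesis
        by (simp add: \<delta>_def E_def algebra_simps add_divide_distrib)
    qed
    then show "\<exists>W. \<forall>B. is_box B \<and> W \<le> width B \<longrightarrow>
        (\<alpha> + c * (\<beta> - \<alpha>) - E / u) * vol B \<le> v B"
      by blast
  qed simp
qed

subsection \<open>Existence of the density\<close>

lemma exists_wide_box: "\<exists>B :: (real ^ 'n) set. is_box B \<and> W \<le> width B"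
proof -
  let ?B = "cube (0 :: real ^ 'n) (max 1 W)"
  have "is_box ?B" "2 * max 1 W \<le> width ?B"
    by (rule cube_box; simp)+
  moreover have "W \<le> 2 * max 1 W"
    by simp
  ultimately show ?thesis by (meson order_trans)
qed

text \<open>The limit is the common value of the lower and the upper limit;
  \<open>density_improvement\<close>, applied to \<open>v\<close> or to \<open>- v\<close>, excludes
  a gap between them.\<close>

lemma scalar_density_exists:
  fixes X :: "(real ^ 'n) set"
  assumes X: "delone X" "densely_repetitive X"
    and loc: "approx_local X U Cb v" "0 \<le> Cb" and add: "approx_additive U Cc v" "0 \<le> Cc"
    and bound: "\<And>B. B \<in> boxes_wider_than U \<Longrightarrow> \<bar>v B\<bar> \<le> Ca * vol B"
  shows "\<exists>f. ((\<lambda>B. v B / vol B) \<longlongrightarrow> f) (width going_to at_top within {B. is_box B})"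
proof -
  \<comment> \<open>\<open>G\<close> and \<open>H\<close> collect the eventual lower and upper
    bounds of the density, so \<open>Sup G\<close> and \<open>Inf H\<close> are its lower and upper
    limits.\<close>
  define G where "G = {x. \<exists>W. \<forall>B. is_box B \<and> W \<le> width B \<longrightarrow> x * vol B \<le> v B}"
  define H where "H = {x. \<exists>W. \<forall>B. is_box B \<and> W \<le> width B \<longrightarrow> v B \<le> x * vol B}"
  have G_mono: "x \<in> G" if x: "y \<in> G" "x \<le> y" for x y
  proof -
    obtain W where W: "\<And>B. is_box B \<Longrightarrow> W \<le> width B \<Longrightarrow> y * vol B \<le> v B"
      using x by (auto simp: G_def)
    have "x * vol B \<le> v B" if "is_box B" "W \<le> width B" for B
      using W[OF that] mult_right_mono[OF x(2), of "vol B"] vol_pos[OF that(1)] by linarith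
    then show ?thesis unfolding G_def by blast
  qed
  have H_mono: "x \<in> H" if x: "y \<in> H" "y \<le> x" for x y
  proof -
    obtain W where W: "\<And>B. is_box B \<Longrightarrow> W \<le> width B \<Longrightarrow> v B \<le> y * vol B"
      using x by (auto simp: H_def)
    have "v B \<le> x * vol B" if "is_box B" "W \<le> width B" for B
      using W[OF that] mult_right_mono[OF x(2), of "vol B"] vol_pos[OF that(1)] by linarith
    then show ?thesis unfolding H_def by blast
  qed
  have G_le_H: "x \<le> y" if xy: "x \<in> G" "y \<in> H" for x y
  proof -
    obtain W1 W2 where W1: "\<And>B. is_box B \<Longrightarrow> W1 \<le> width B \<Longrightarrow> x * vol B \<le> v B"
      and W2: "\<And>B. is_box B \<Longrightarrow> W2 \<le> width B \<Longrightarrow> v B \<le> y * vol B"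
      using xy by (auto simp: G_def H_def)
    obtain B :: "(real ^ 'n) set" where B: "is_box B" "max W1 W2 \<le> width B"
      using exists_wide_box by blast
    then have "x * vol B \<le> y * vol B"
      using W1[of B] W2[of B] by auto
    then show ?thesis using vol_pos[OF B(1)] by simp
  qed
  have wide: "B \<in> boxes_wider_than U" if "is_box B" "U + 1 \<le> width B" for B :: "(real ^ 'n) set"
    using that by (simp add: boxes_wider_than_def)
  have "- Ca * vol B \<le> v B \<and> v B \<le> Ca * vol B" if "is_box B" "U + 1 \<le> width B" for B
    using bound[OF wide[OF that]] by (simp add: abs_le_iff)
  then have Ca: "- Ca \<in> G" "Ca \<in> H"
    unfolding G_def H_def by blast+
  define L where "L = Sup G"
  define M where "M = Inf H"
  have bdd: "bdd_above G" "bdd_below H"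
    using G_le_H Ca by (auto intro!: bdd_aboveI[of _ Ca] bdd_belowI[of _ "- Ca"])
  have L_upper: "x \<le> L" if "x \<in> G" for x
    unfolding L_def by (rule cSup_upper[OF that bdd(1)])
  have M_lower: "M \<le> x" if "x \<in> H" for x
    unfolding M_def by (rule cInf_lower[OF that bdd(2)])
  have G_less: "x \<in> G" if "x < L" for x
    using that Ca G_mono unfolding L_def by (metis empty_iff less_cSupE less_imp_le)
  have H_less: "x \<in> H" if "M < x" for x
    using that Ca H_mono unfolding M_def by (metis cInf_lessD empty_iff less_imp_le)
  have "L \<le> M"
    unfolding L_def M_def using Ca G_le_H by (intro cSup_least cInf_greatest) auto
  have "M \<le> L"
  proof (rule ccontr)
    assume "\<not> M \<le> L"
    then have LM: "L < M" by simp
    obtain c E u0 where c: "c > 0" and u0: "u0 > 0" and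
      improve: "\<And>U v u \<alpha> \<beta> Y. approx_local X U Cb v \<Longrightarrow> approx_additive U Cc v \<Longrightarrow> U < u \<Longrightarrow> u0 \<le> u \<Longrightarrow>
        (\<And>B. is_box B \<Longrightarrow> u \<le> width B \<Longrightarrow> \<alpha> * vol B \<le> v B) \<Longrightarrow>
        Y \<subseteq> X \<Longrightarrow> (\<And>y. y \<in> Y \<Longrightarrow> \<beta> * vol (cube y u) \<le> v (cube y u)) \<Longrightarrow>
        patch_count X (real CARD('n) * u) \<le> 2 * card (patch X (real CARD('n) * u) ` Y) \<Longrightarrow>
        \<exists>W. \<forall>B. is_box B \<and> W \<le> width B \<longrightarrow> (\<alpha> + c * (\<beta> - \<alpha>) - E / u) * vol B \<le> v B"
      using density_improvement[OF X loc(2) add(2)] by metis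
    \<comment> \<open>The improvement starts at \<open>L - \<epsilon>\<close>, gains more than
      \<open>4 * \<epsilon>\<close> and loses at most \<open>\<epsilon>\<close> through
      \<open>E / u\<close>, so it ends above \<open>L\<close>; symmetrically at
      \<open>M\<close>.\<close>
    define \<epsilon> where "\<epsilon> = c * (M - L) / 8"
    define \<beta> where "\<beta> = (L + M) / 2"
    have \<epsilon>: "\<epsilon> > 0" using c LM by (simp add: \<epsilon>_def)
    have gain: "c * (\<beta> - L) = 4 * \<epsilon>" "c * (M - \<beta>) = 4 * \<epsilon>"
      by (simp_all add: \<epsilon>_def \<beta>_def field_simps)
    have "L - \<epsilon> \<in> G" "M + \<epsilon> \<in> H"
      using \<epsilon> by (auto intro: G_less H_less)
    then obtain W1 W2 where W1: "\<And>B. is_box B \<Longrightarrow> W1 \<le> width B \<Longrightarrow> (L - \<epsilon>) * vol B \<le> v B"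
      and W2: "\<And>B. is_box B \<Longrightarrow> W2 \<le> width B \<Longrightarrow> v B \<le> (M + \<epsilon>) * vol B"
      by (auto simp: G_def H_def)
    \<comment> \<open>\<open>c\<close> and \<open>E\<close> are fixed already, so the scale may
      depend on them through \<open>\<epsilon>\<close> and \<open>E / \<epsilon>\<close>.\<close>
    define u where "u = Max {u0, U + 1, W1, W2, E / \<epsilon>}"
    have u: "u0 \<le> u" "U + 1 \<le> u" "W1 \<le> u" "W2 \<le> u" "E / \<epsilon> \<le> u"
      by (simp_all add: u_def)
    have E: "E / u \<le> \<epsilon>"
      using u(1,5) u0 \<epsilon> by (simp add: field_simps)
    define T where "T = real CARD('n) * u"
    define Y1 where "Y1 = {y \<in> X. \<beta> * vol (cube y u) \<le> v (cube y u)}"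
    define Y2 where "Y2 = {y \<in> X. - \<beta> * vol (cube y u) \<le> - v (cube y u)}"
    \<comment> \<open>\<open>Y1\<close> and \<open>Y2\<close> cover \<open>X\<close>. A patch may
      arise from both, but one of the two sets accounts for at least half of the patches.\<close>
    have "patch X T ` X = patch X T ` Y1 \<union> patch X T ` Y2"
      unfolding image_Un[symmetric] by (rule arg_cong[of _ _ "image _"]) (auto simp: Y1_def Y2_def)
    then have "patch_count X T \<le> card (patch X T ` Y1) + card (patch X T ` Y2)"
      unfolding patch_count_def by (simp add: card_Un_le)
    then consider "patch_count X T \<le> 2 * card (patch X T ` Y1)"
      | "patch_count X T \<le> 2 * card (patch X T ` Y2)"
      by linarith
    then show False
    proof cases
      case 1
      have "\<exists>W. \<forall>B. is_box B \<and> W \<le> width B \<longrightarrow>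
          (L - \<epsilon> + c * (\<beta> - (L - \<epsilon>)) - E / u) * vol B \<le> v B"
        by (rule improve[OF loc(1) add(1) _ u(1), where Y = Y1])
          (use 1 u W1 in \<open>auto simp: Y1_def T_def\<close>)
      then have "L - \<epsilon> + c * (\<beta> - (L - \<epsilon>)) - E / u \<in> G"
        by (simp add: G_def)
      then have "L - \<epsilon> + c * (\<beta> - (L - \<epsilon>)) - E / u \<le> L"
        by (rule L_upper)
      moreover have "c * (\<beta> - (L - \<epsilon>)) = 4 * \<epsilon> + c * \<epsilon>"
        using gain(1) by (simp add: algebra_simps)
      moreover have "c * \<epsilon> > 0" using c \<epsilon> by simp
      ultimately show False using E \<epsilon> by linarith
    next
      case 2
      \<comment> \<open>For \<open>- v\<close> the lower bound is \<open>- (M + \<epsilon>)\<close>,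
        and the rich cubes are those where \<open>v\<close> has density at most
        \<open>\<beta>\<close>. Raising that bound pushes an upper bound for \<open>v\<close> below
        \<open>M\<close>.\<close>
      have "\<exists>W. \<forall>B. is_box B \<and> W \<le> width B \<longrightarrow>
          (- (M + \<epsilon>) + c * (- \<beta> - - (M + \<epsilon>)) - E / u) * vol B \<le> - v B"
      proof (rule improve[OF approx_local_uminus[OF loc(1)] approx_additive_uminus[OF add(1)] _ u(1),
            where Y = Y2])
        show "- (M + \<epsilon>) * vol B \<le> - v B" if "is_box B" "u \<le> width B" for B
          unfolding mult_minus_left neg_le_iff_le by (rule W2) (use that u(4) in auto)
      qed (use 2 u in \<open>auto simp: Y2_def T_def\<close>)
      then have "\<exists>W. \<forall>B. is_box B \<and> W \<le> width B \<longrightarrow>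
          v B \<le> - (- (M + \<epsilon>) + c * (- \<beta> - - (M + \<epsilon>)) - E / u) * vol B"
        by (simp only: mult_minus_left le_minus_iff)
      then have "- (- (M + \<epsilon>) + c * (- \<beta> - - (M + \<epsilon>)) - E / u) \<in> H"
        unfolding H_def by blast
      then have "M \<le> - (- (M + \<epsilon>) + c * (- \<beta> - - (M + \<epsilon>)) - E / u)"
        by (rule M_lower)
      moreover have "c * (- \<beta> - - (M + \<epsilon>)) = 4 * \<epsilon> + c * \<epsilon>"
        using gain(2) by (simp add: algebra_simps)
      moreover have "c * \<epsilon> > 0" using c \<epsilon> by simp
      ultimately show False using E \<epsilon> by linarith
    qed
  qed
  with \<open>L \<le> M\<close> have LM: "M = L" by simp
  have "((\<lambda>B. v B / vol B) \<longlongrightarrow> L) (width going_to at_top within {B. is_box B})"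
  proof (rule order_tendstoI)
    fix x assume x: "x < L"
    obtain y where y: "x < y" "y < L" using dense[OF x] by blast
    obtain W where "\<And>B. is_box B \<Longrightarrow> W \<le> width B \<Longrightarrow> y * vol B \<le> v B"
      using G_less[OF y(2)] by (auto simp: G_def)
    then have "x < v B / vol B" if "is_box B" "W \<le> width B" for B
      using that vol_pos[OF that(1)] y(1) by (force simp: pos_less_divide_eq
          intro: less_le_trans[OF mult_strict_right_mono])
    then show "\<forall>\<^sub>F B in width going_to at_top within {B. is_box B}. x < v B / vol B"
      unfolding eventually_going_to_at_top_linorder by blast
  next
    fix x assume x: "L < x"
    obtain y where y: "L < y" "y < x" using dense[OF x] by blast
    obtain W where "\<And>B. is_box B \<Longrightarrow> W \<le> width B \<Longrightarrow> v B \<le> y * vol B"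
      using H_less[of y] y(1) LM by (auto simp: H_def)
    then have "v B / vol B < x" if "is_box B" "W \<le> width B" for B
      using that vol_pos[OF that(1)] y(2) by (force simp: pos_divide_less_eq
          intro: le_less_trans[OF _ mult_strict_right_mono])
    then show "\<forall>\<^sub>F B in width going_to at_top within {B. is_box B}. v B / vol B < x"
      unfolding eventually_going_to_at_top_linorder by blast
  qed
  then show ?thesis by blast
qed

theorem theorem5p2:
  fixes X :: "(real ^ 'n) set" and w :: "(real ^ 'n) set \<Rightarrow> real ^ 's"
  assumes "delone X"
    and "densely_repetitive X"
    and "local_weight_distribution X w"
  shows "\<exists>f. ((\<lambda>B. w B /\<^sub>R vol B) \<longlongrightarrow> f) (width going_to at_top within {B. is_box B})"
proof -
  obtain U Ca Cb Cc where
    a: "\<And>B. B \<in> boxes_wider_than U \<Longrightarrow> norm (w B) \<le> Ca * vol B" and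
    b: "\<And>B t. B \<in> boxes_wider_than U \<Longrightarrow> (+) t ` B \<inter> X = (+) t ` (B \<inter> X) \<Longrightarrow>
      norm (w ((+) t ` B) - w B) \<le> Cb * surface_area B" and
    c: "\<And>B D. B \<in> boxes_wider_than U \<Longrightarrow> D \<subseteq> boxes_wider_than U \<Longrightarrow> D division_of B \<Longrightarrow>
      norm (w B - (\<Sum>K\<in>D. w K)) \<le> Cc * (\<Sum>K\<in>D. surface_area K)"
    using assms(3) unfolding local_weight_distribution_def by metis
  \<comment> \<open>Each coordinate is bounded by the norm and so inherits the three conditions.
    Absolute values make the constants of (b) and (c) nonnegative, as the scalar result
    requires.\<close>
  have "\<exists>f. ((\<lambda>B. w B $ j / vol B) \<longlongrightarrow> f) (width going_to at_top within {B. is_box B})" for j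
  proof (rule scalar_density_exists[OF assms(1,2)])
    show "approx_local X U \<bar>Cb\<bar> (\<lambda>B. w B $ j)"
      unfolding approx_local_def
    proof (intro ballI allI impI)
      fix B :: "(real ^ 'n) set" and t
      assume B: "B \<in> boxes_wider_than U" "(+) t ` B \<inter> X = (+) t ` (B \<inter> X)"
      have "\<bar>w ((+) t ` B) $ j - w B $ j\<bar> \<le> norm (w ((+) t ` B) - w B)"
        using component_le_norm_cart[of "w ((+) t ` B) - w B" j] by simp
      also have "\<dots> \<le> Cb * surface_area B"
        by (rule b[OF B])
      also have "\<dots> \<le> \<bar>Cb\<bar> * surface_area B"
        using B(1) by (intro mult_right_mono surface_area_nonneg) (auto simp: boxes_wider_than_def)
      finally show "\<bar>w ((+) t ` B) $ j - w B $ j\<bar> \<le> \<bar>Cb\<bar> * surface_area B" .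
    qed
    show "approx_additive U \<bar>Cc\<bar> (\<lambda>B. w B $ j)"
      unfolding approx_additive_def
    proof (intro ballI allI impI)
      fix B :: "(real ^ 'n) set" and D
      assume B: "B \<in> boxes_wider_than U" "D \<subseteq> boxes_wider_than U" "D division_of B"
      have "\<bar>w B $ j - (\<Sum>K\<in>D. w K $ j)\<bar> \<le> norm (w B - (\<Sum>K\<in>D. w K))"
        using component_le_norm_cart[of "w B - (\<Sum>K\<in>D. w K)" j] by (simp add: sum_component)
      also have "\<dots> \<le> Cc * (\<Sum>K\<in>D. surface_area K)"
        by (rule c[OF B])
      also have "\<dots> \<le> \<bar>Cc\<bar> * (\<Sum>K\<in>D. surface_area K)"
        using B(2) by (intro mult_right_mono sum_nonneg surface_area_nonneg)
          (auto simp: boxes_wider_than_def)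
      finally show "\<bar>w B $ j - (\<Sum>K\<in>D. w K $ j)\<bar> \<le> \<bar>Cc\<bar> * (\<Sum>K\<in>D. surface_area K)" .
    qed
    show "\<bar>w B $ j\<bar> \<le> Ca * vol B" if "B \<in> boxes_wider_than U" for B
      using a[OF that] component_le_norm_cart[of "w B" j] by linarith
  qed auto
  then obtain f where f: "\<And>j. ((\<lambda>B. w B $ j / vol B) \<longlongrightarrow> f j)
      (width going_to at_top within {B. is_box B})"
    by metis
  have "((\<lambda>B. w B /\<^sub>R vol B) \<longlongrightarrow> (\<chi> j. f j)) (width going_to at_top within {B. is_box B})"
    using f by (intro vec_tendstoI) (simp add: divide_inverse mult.commute)
  then show ?thesis by blast
qed

end
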